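(* Let $G$ be a finite primitive permutation group whose point-stabilisers $G_\alpha$ are dihedral groups. Then $G$ is of affine type or of almost simple type.
   Context: A permutation group on a set is primitive if it is transitive and the only equivalence relations it preserves are the identity and the universal relation; equivalently, it is transitive with point-stabilisers that are maximal subgroups. $\mathrm{D}_n$ denotes the dihedral group of order $2n$. A group $G$ is almost simple if $T\le G\le \mathrm{Aut}\,T$ for some non-abelian finite simple group $T$ (where $T$ is identified with its group of inner automorphisms). A permutation group $G$ is of affine type if it has an elementary abelian normal subgroup $V$ acting regularly; then $V$ can be regarded as a $d$-dimensional vector space over $\mathbb{F}_p$, where $|V|=p^d$ with $p$ prime, and $G=V\rtimes G_0\le \mathrm{AGL}_d(p)$, where $G_0$ is the stabiliser of $0\in V$. *)

theory Defs
  imports "HOL-Algebra.Algebra"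
begin

text \<open>
  A permutation group on \<open>\<Omega>\<close> is a subgroup \<open>G\<close> of \<open>BijGroup \<Omega>\<close>. Its elements are extensional
  functions, and it acts on \<open>\<Omega>\<close> by evaluation, so its action map is \<open>\<lambda>g. g\<close>.
\<close>

abbreviation perm_group :: "'a set \<Rightarrow> ('a \<Rightarrow> 'a) set \<Rightarrow> ('a \<Rightarrow> 'a) monoid" where
  "perm_group \<Omega> G \<equiv> BijGroup \<Omega> \<lparr>carrier := G\<rparr>"

abbreviation point_stabilizer :: "'a set \<Rightarrow> ('a \<Rightarrow> 'a) set \<Rightarrow> 'a \<Rightarrow> ('a \<Rightarrow> 'a) set" where
  "point_stabilizer \<Omega> G \<alpha> \<equiv> stabilizer (perm_group \<Omega> G) (\<lambda>g. g) \<alpha>"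

definition transitive_perm_group :: "'a set \<Rightarrow> ('a \<Rightarrow> 'a) set \<Rightarrow> bool" where
  "transitive_perm_group \<Omega> G \<longleftrightarrow>
     subgroup G (BijGroup \<Omega>) \<and> transitive_action (perm_group \<Omega> G) \<Omega> (\<lambda>g. g)"

definition primitive_perm_group :: "'a set \<Rightarrow> ('a \<Rightarrow> 'a) set \<Rightarrow> bool" where
  "primitive_perm_group \<Omega> G \<longleftrightarrow>
     transitive_perm_group \<Omega> G \<and>
     (\<forall>r. equiv \<Omega> r \<and> (\<forall>g\<in>G. \<forall>(x, y)\<in>r. (g x, g y) \<in> r) \<longrightarrow> r = Id_on \<Omega> \<or> r = \<Omega> \<times> \<Omega>)"

definition regular_perm_group :: "'a set \<Rightarrow> ('a \<Rightarrow> 'a) set \<Rightarrow> bool" where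
  "regular_perm_group \<Omega> G \<longleftrightarrow>
     transitive_perm_group \<Omega> G \<and> (\<forall>\<alpha>\<in>\<Omega>. point_stabilizer \<Omega> G \<alpha> = {\<one>\<^bsub>BijGroup \<Omega>\<^esub>})"

text \<open>
  The semidirect product of the integers modulo \<open>n\<close> with a group of order two acting by inversion:
  \<open>(i, False)\<close> is the rotation \<open>x \<mapsto> x + i\<close> and \<open>(i, True)\<close> the reflection \<open>x \<mapsto> i - x\<close>.
  For \<open>n = 0\<close> this is the infinite dihedral group.
\<close>

definition dihedral_group :: "nat \<Rightarrow> (int \<times> bool) monoid" where
  "dihedral_group n =
     \<lparr>carrier = carrier (integer_mod_group n) \<times> UNIV,
      monoid.mult = (\<lambda>(i, s) (j, t). ((if s then i - j else i + j) mod int n, s \<noteq> t)),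
      one = (0, False)\<rparr>"

lemma group_dihedral_group: "group (dihedral_group n)"
proof (rule groupI)
  fix x y z
  assume "x \<in> carrier (dihedral_group n)" "y \<in> carrier (dihedral_group n)"
    "z \<in> carrier (dihedral_group n)"
  then show "x \<otimes>\<^bsub>dihedral_group n\<^esub> y \<otimes>\<^bsub>dihedral_group n\<^esub> z =
      x \<otimes>\<^bsub>dihedral_group n\<^esub> (y \<otimes>\<^bsub>dihedral_group n\<^esub> z)"
    by (cases x; cases y; cases z) (auto simp: dihedral_group_def mod_simps algebra_simps)
next
  fix x assume x: "x \<in> carrier (dihedral_group n)"
  obtain i s where xis: "x = (i, s)" by (cases x)
  let ?y = "if s then x else ((- i) mod int n, False)"
  have "?y \<in> carrier (dihedral_group n)" "?y \<otimes>\<^bsub>dihedral_group n\<^esub> x = \<one>\<^bsub>dihedral_group n\<^esub>"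
    using x xis by (auto simp: dihedral_group_def carrier_integer_mod_group mod_simps)
  then show "\<exists>y\<in>carrier (dihedral_group n). y \<otimes>\<^bsub>dihedral_group n\<^esub> x = \<one>\<^bsub>dihedral_group n\<^esub>"
    by blast
qed (auto simp: dihedral_group_def carrier_integer_mod_group split: if_splits)

lemma order_dihedral_group: "n \<ge> 1 \<Longrightarrow> order (dihedral_group n) = 2 * n"
  by (simp add: order_def dihedral_group_def carrier_integer_mod_group card_cartesian_product)

text \<open>The degenerate cases of order two (\<open>n = 1\<close>) and of Klein's four-group (\<open>n = 2\<close>) count.\<close>

definition is_dihedral :: "('a, 'b) monoid_scheme \<Rightarrow> bool" where
  "is_dihedral H \<longleftrightarrow> (\<exists>n\<ge>1. H \<cong> dihedral_group n)"

definition elementary_abelian :: "('a, 'b) monoid_scheme \<Rightarrow> bool" where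
  "elementary_abelian V \<longleftrightarrow>
     comm_group V \<and> (\<exists>p::nat. Factorial_Ring.prime p \<and> (\<forall>v\<in>carrier V. v [^]\<^bsub>V\<^esub> p = \<one>\<^bsub>V\<^esub>))"

definition affine_type :: "'a set \<Rightarrow> ('a \<Rightarrow> 'a) set \<Rightarrow> bool" where
  "affine_type \<Omega> G \<longleftrightarrow>
     (\<exists>V. V \<lhd> perm_group \<Omega> G \<and> elementary_abelian (perm_group \<Omega> V) \<and> regular_perm_group \<Omega> V)"

definition inner_automorphisms :: "('a, 'b) monoid_scheme \<Rightarrow> ('a \<Rightarrow> 'a) set" where
  "inner_automorphisms T =
     {\<lambda>x\<in>carrier T. t \<otimes>\<^bsub>T\<^esub> x \<otimes>\<^bsub>T\<^esub> inv\<^bsub>T\<^esub> t | t. t \<in> carrier T}"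

text \<open>
  The type of \<open>T\<close> is no restriction: \<open>T\<close> is centreless, hence isomorphic to its group of inner
  automorphisms, and so to a subgroup of \<open>G\<close>.
\<close>

definition almost_simple :: "('a, 'b) monoid_scheme \<Rightarrow> bool" where
  "almost_simple G \<longleftrightarrow>
     (\<exists>(T :: 'a monoid) A.
        simple_group T \<and> finite (carrier T) \<and> \<not> comm_group T \<and>
        subgroup A (AutoGroup T) \<and> inner_automorphisms T \<subseteq> A \<and>
        G \<cong> AutoGroup T \<lparr>carrier := A\<rparr>)"

end

theory Submission
  imports Defs
begin

text \<open>
  Let \<open>H\<close> be a point stabiliser. Primitivity says that \<open>H\<close> is maximal in \<open>G\<close>, and faithfulness of
  the action that \<open>H\<close> contains no normal subgroup of \<open>G\<close> except \<open>1\<close>. Let \<open>N\<close> be a minimal normal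
  subgroup of \<open>G\<close>; then \<open>G = N H\<close>. The proof is elementary and rests on a dichotomy: if
  \<open>C\<^sub>G(N) \<noteq> 1\<close> then also \<open>G = C\<^sub>G(N) H\<close>, so \<open>N \<inter> H\<close>, which \<open>H\<close> normalises and \<open>C\<^sub>G(N)\<close>
  centralises, is normal in \<open>G\<close> and hence trivial. So \<open>N \<inter> H = 1\<close> or \<open>C\<^sub>G(N) = 1\<close>.

  Suppose \<open>N \<inter> H = 1\<close>. By maximality the only \<open>H\<close>-invariant subgroups of \<open>N\<close> are \<open>1\<close> and \<open>N\<close>. A
  dihedral group has an element \<open>a \<noteq> 1\<close> whose conjugates all lie in \<open>{a, a\<^sup>-\<^sup>1}\<close>; then \<open>C\<^sub>N(a)\<close> is
  \<open>H\<close>-invariant, so \<open>a\<close> acts on \<open>N\<close> without nontrivial fixed points. Such an automorphism of a finite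
  group leaves exactly one Sylow \<open>q\<close>-subgroup invariant (\<open>ex1_fixed_point_free_sylow\<close>), which is
  therefore invariant under \<open>H\<close> as well, and so is all of \<open>N\<close>. As the centre of a \<open>q\<close>-group is
  nontrivial, \<open>N\<close> is abelian (\<open>minimal_normal_complement_commutative\<close>); it is then elementary abelian
  and regular, and \<open>G\<close> is affine.

  Suppose \<open>C\<^sub>G(N) = 1 \<noteq> N \<inter> H\<close>, and let \<open>T\<close> be a minimal normal subgroup of \<open>N\<close>. Distinct conjugates
  of \<open>T\<close> commute, so \<open>N = T \<times> M\<close> with \<open>M = C\<^sub>N(T)\<close>, and \<open>T\<close> is simple and non-abelian. If \<open>T = N\<close> then
  \<open>G\<close>, acting faithfully on \<open>N\<close> by conjugation, is almost simple. Otherwise put \<open>D = N \<inter> H\<close>. The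
  intersection of the \<open>H\<close>-conjugates of \<open>M D\<close> is \<open>D\<close> or \<open>N\<close>. It is not \<open>N\<close>: then \<open>T\<close> would be a
  quotient of \<open>D\<close> and satisfy the law \<open>x\<^sup>2 y\<^sup>2 = y\<^sup>2 x\<^sup>2\<close> of dihedral groups. So it is \<open>D\<close>, which
  gives \<open>D \<subseteq> (T \<inter> H) M\<close> and \<open>T \<inter> H \<noteq> 1\<close>. A rotation in \<open>T \<inter> H\<close> lies, up to inversion, in
  each \<open>H\<close>-conjugate of \<open>T\<close>, of which there are at least two; so it is trivial, and \<open>T \<inter> H = {1, t}\<close>
  for a reflection \<open>t\<close>. An element of \<open>T\<close> that commutes with \<open>t\<close> centralises \<open>D\<close>, and the centraliser
  of \<open>D\<close> is contained in \<open>H\<close> by maximality. Hence \<open>t\<close> is an involution with \<open>C\<^sub>T(t) = {1, t}\<close>, and the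
  elements of \<open>T\<close> that are not conjugate to \<open>t\<close> form a normal subgroup of index two
  (\<open>self_centralizing_involution\<close>), which is absurd (\<open>minimal_normal_simple_if_dihedral\<close>).
\<close>

section \<open>Conjugation, normalisers and centralisers\<close>

context group
begin

lemma inv_mult_cancel_left: "x \<in> carrier G \<Longrightarrow> y \<in> carrier G \<Longrightarrow> inv x \<otimes> (x \<otimes> y) = y"
  by (simp flip: m_assoc)

lemma mult_inv_cancel_left: "x \<in> carrier G \<Longrightarrow> y \<in> carrier G \<Longrightarrow> x \<otimes> (inv x \<otimes> y) = y"
  by (simp flip: m_assoc)

lemmas word_simps = m_assoc inv_mult_group inv_mult_cancel_left mult_inv_cancel_left

definition conj_by :: "'a \<Rightarrow> 'a \<Rightarrow> 'a" where
  "conj_by g x = g \<otimes> x \<otimes> inv g"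

definition normalizes :: "'a set \<Rightarrow> 'a set \<Rightarrow> bool" where
  "normalizes K U \<longleftrightarrow> (\<forall>g\<in>K. \<forall>x\<in>U. conj_by g x \<in> U)"

definition centralizer :: "'a set \<Rightarrow> 'a set" where
  "centralizer U = {g \<in> carrier G. \<forall>x\<in>U. g \<otimes> x = x \<otimes> g}"

text \<open>
  For a subgroup \<open>K\<close> this is the intersection of the \<open>K\<close>-conjugates of \<open>L\<close>, the largest part of \<open>L\<close>
  that \<open>K\<close> leaves invariant; for \<open>K = G\<close> it is the normal core of \<open>L\<close>.
\<close>

definition core_in :: "'a set \<Rightarrow> 'a set \<Rightarrow> 'a set" where
  "core_in K L = {x \<in> carrier G. \<forall>g\<in>K. conj_by g x \<in> L}"

lemma conj_by_closed [simp, intro]: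
  "g \<in> carrier G \<Longrightarrow> x \<in> carrier G \<Longrightarrow> conj_by g x \<in> carrier G"
  by (simp add: conj_by_def)

lemma conj_by_simps [simp]:
  assumes "g \<in> carrier G" "x \<in> carrier G"
  shows "conj_by \<one> x = x" "conj_by g \<one> = \<one>" "conj_by g (inv x) = inv (conj_by g x)"
    "conj_by (inv g) (conj_by g x) = x" "conj_by g (conj_by (inv g) x) = x"
  using assms by (simp_all add: conj_by_def word_simps)

lemma conj_by_mult:
  "g \<in> carrier G \<Longrightarrow> x \<in> carrier G \<Longrightarrow> y \<in> carrier G \<Longrightarrow>
    conj_by g (x \<otimes> y) = conj_by g x \<otimes> conj_by g y"
  by (simp add: conj_by_def word_simps)

lemma conj_by_conj_by:
  "g \<in> carrier G \<Longrightarrow> h \<in> carrier G \<Longrightarrow> x \<in> carrier G \<Longrightarrow>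
    conj_by (g \<otimes> h) x = conj_by g (conj_by h x)"
  by (simp add: conj_by_def word_simps)

lemma conj_by_eq_iff_commute:
  assumes "g \<in> carrier G" "x \<in> carrier G"
  shows "conj_by g x = x \<longleftrightarrow> g \<otimes> x = x \<otimes> g"
proof -
  have "conj_by g x = x \<longleftrightarrow> conj_by g x \<otimes> g = x \<otimes> g"
    using assms by (simp add: r_cancel)
  then show ?thesis using assms by (simp add: conj_by_def word_simps)
qed

lemma inj_on_conj_by: "g \<in> carrier G \<Longrightarrow> inj_on (conj_by g) (carrier G)"
  by (rule inj_on_inverseI[where g = "conj_by (inv g)"]) simp

lemma conj_by_eq_one_iff [simp]:
  "g \<in> carrier G \<Longrightarrow> x \<in> carrier G \<Longrightarrow> conj_by g x = \<one> \<longleftrightarrow> x = \<one>"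
  by (metis conj_by_simps(2,4) inv_closed)

lemma subgroup_conj_image:
  assumes g: "g \<in> carrier G" and P: "subgroup P G"
  shows "subgroup (conj_by g ` P) G"
proof -
  have "group_hom G G (conj_by g)"
    using g by unfold_locales (auto simp: hom_def conj_by_mult)
  then show ?thesis
    using P by (rule group_hom.subgroup_img_is_subgroup)
qed

lemma card_conj_image: "g \<in> carrier G \<Longrightarrow> P \<subseteq> carrier G \<Longrightarrow> card (conj_by g ` P) = card P"
  by (meson card_image inj_on_conj_by inj_on_subset)

lemma normalizesD: "normalizes K U \<Longrightarrow> g \<in> K \<Longrightarrow> x \<in> U \<Longrightarrow> conj_by g x \<in> U"
  by (simp add: normalizes_def)

lemma normal_iff_normalizes: "N \<lhd> G \<longleftrightarrow> subgroup N G \<and> normalizes (carrier G) N"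
  by (simp add: normal_inv_iff normalizes_def conj_by_def)

lemma conj_image_eq:
  assumes "finite U" "U \<subseteq> carrier G" "g \<in> carrier G" "\<And>x. x \<in> U \<Longrightarrow> conj_by g x \<in> U"
  shows "conj_by g ` U = U"
  using assms by (intro card_subset_eq) (auto simp: card_conj_image)

text \<open>
  The definition of \<open>normalizes\<close> only asks for an inclusion; for finite sets an injective map that
  preserves a set permutes it.
\<close>

lemma normalizes_inv:
  assumes "finite U" "U \<subseteq> carrier G" "g \<in> carrier G" "normalizes {g} U"
  shows "normalizes {inv g} U"
proof -
  have "conj_by g ` U = U"
    using assms by (intro conj_image_eq) (auto simp: normalizes_def)
  moreover have "conj_by (inv g) (conj_by g x) = x" if "x \<in> U" for x
    using that assms by (intro conj_by_simps(4)) auto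
  ultimately have "conj_by (inv g) y \<in> U" if "y \<in> U" for y
    using that by (metis imageE)
  then show ?thesis by (simp add: normalizes_def)
qed

lemma normalizes_subgroup: "subgroup U G \<Longrightarrow> normalizes U U"
  by (simp add: normalizes_def conj_by_def subgroup.m_closed subgroup.m_inv_closed)

lemma normalizes_subset: "normalizes K U \<Longrightarrow> K' \<subseteq> K \<Longrightarrow> normalizes K' U"
  by (auto simp: normalizes_def)

lemma normalizes_Int: "normalizes K U \<Longrightarrow> normalizes K Y \<Longrightarrow> normalizes K (U \<inter> Y)"
  by (auto simp: normalizes_def)

lemma normalizes_set_mult:
  assumes "normalizes K U" "normalizes L U" "K \<subseteq> carrier G" "L \<subseteq> carrier G" "U \<subseteq> carrier G"
  shows "normalizes (K <#> L) U"
  using assms by (force simp: normalizes_def set_mult_def conj_by_conj_by subset_iff)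

lemma subgroup_centralizer: "U \<subseteq> carrier G \<Longrightarrow> subgroup (centralizer U) G"
proof (rule subgroupI)
  assume U: "U \<subseteq> carrier G"
  show "centralizer U \<subseteq> carrier G" "centralizer U \<noteq> {}"
    using U by (auto simp: centralizer_def intro!: exI[of _ \<one>])
  fix g assume g: "g \<in> centralizer U"
  then have "inv g \<otimes> x = x \<otimes> inv g" if "x \<in> U" for x
  proof -
    have x: "x \<in> carrier G" and gx: "g \<otimes> x = x \<otimes> g" "g \<in> carrier G"
      using g that U by (auto simp: centralizer_def)
    have "inv g \<otimes> x = inv g \<otimes> (x \<otimes> g) \<otimes> inv g"
      using x gx(2) by (simp add: word_simps)
    also have "\<dots> = inv g \<otimes> (g \<otimes> x) \<otimes> inv g"
      by (simp only: gx(1))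
    also have "\<dots> = x \<otimes> inv g"
      using x gx(2) by (simp add: word_simps)
    finally show ?thesis .
  qed
  then show "inv g \<in> centralizer U" using g by (simp add: centralizer_def)
  fix h assume h: "h \<in> centralizer U"
  have "g \<otimes> h \<otimes> x = x \<otimes> (g \<otimes> h)" if "x \<in> U" for x
  proof -
    have c: "g \<in> carrier G" "h \<in> carrier G" "x \<in> carrier G"
      and e: "g \<otimes> x = x \<otimes> g" "h \<otimes> x = x \<otimes> h"
      using g h U that by (auto simp: centralizer_def)
    have "g \<otimes> h \<otimes> x = g \<otimes> x \<otimes> h"
      using c by (simp add: m_assoc e(2))
    then show ?thesis using c by (simp add: m_assoc e(1))
  qed
  then show "g \<otimes> h \<in> centralizer U" using g h by (simp add: centralizer_def)
qed

lemma centralizer_normalizes: "U \<subseteq> carrier G \<Longrightarrow> Y \<subseteq> U \<Longrightarrow> normalizes (centralizer U) Y"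
  by (auto simp: normalizes_def centralizer_def subset_iff conj_by_eq_iff_commute[THEN iffD2])

lemma normalizes_centralizer:
  assumes "subgroup K G" "U \<subseteq> carrier G" "normalizes K U"
  shows "normalizes K (centralizer U)"
  unfolding normalizes_def
proof (intro ballI)
  fix g c assume g: "g \<in> K" and c: "c \<in> centralizer U"
  have gG: "g \<in> carrier G" "inv g \<in> K" "c \<in> carrier G"
    using assms g c by (auto simp: subgroup.mem_carrier subgroup.m_inv_closed centralizer_def)
  have "conj_by g c \<otimes> x = x \<otimes> conj_by g c" if x: "x \<in> U" for x
  proof -
    have xG: "x \<in> carrier G" using x assms by auto
    have "conj_by (inv g) x \<in> U"
      using assms gG x by (blast dest: normalizesD)
    then have "c \<otimes> conj_by (inv g) x = conj_by (inv g) x \<otimes> c"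
      using c by (simp add: centralizer_def)
    then have "conj_by g (c \<otimes> conj_by (inv g) x) = conj_by g (conj_by (inv g) x \<otimes> c)"
      by simp
    then show ?thesis using gG xG by (simp add: conj_by_mult)
  qed
  then show "conj_by g c \<in> centralizer U"
    using gG by (simp add: centralizer_def)
qed

lemma subgroup_core_in:
  assumes K: "K \<subseteq> carrier G" and L: "subgroup L G"
  shows "subgroup (core_in K L) G"
proof (rule subgroupI)
  show "core_in K L \<noteq> {}"
    using assms by (auto simp: core_in_def subgroup.one_closed intro!: exI[of _ \<one>])
qed (use assms in \<open>auto simp: core_in_def conj_by_mult subgroup.m_closed subgroup.m_inv_closed subset_iff\<close>)

lemma normalizes_core_in: "subgroup K G \<Longrightarrow> normalizes K (core_in K L)"
  by (auto simp: normalizes_def core_in_def conj_by_conj_by[symmetric]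
      subgroup.mem_carrier subgroup.m_closed)

lemma core_in_subset: "subgroup K G \<Longrightarrow> core_in K L \<subseteq> L"
  by (auto simp: core_in_def dest!: bspec[OF _ subgroup.one_closed])

lemma subgroup_set_mult_normalizes:
  assumes U: "subgroup U G" and K: "subgroup K G" and n: "normalizes K U"
  shows "subgroup (U <#> K) G"
proof (rule subgroupI)
  show "U <#> K \<subseteq> carrier G" 
    using assms by (auto simp: set_mult_def subgroup.mem_carrier)
  show "U <#> K \<noteq> {}"
    using assms by (auto simp: set_mult_def dest!: subgroup.one_closed)
  fix g assume "g \<in> U <#> K"
  then obtain x k where g: "x \<in> U" "k \<in> K" "g = x \<otimes> k" by (auto simp: set_mult_def)
  have c: "x \<in> carrier G" "k \<in> carrier G" "inv x \<in> U" "inv k \<in> K"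
    using g assms by (auto simp: subgroup.mem_carrier subgroup.m_inv_closed)
  have "inv g = conj_by (inv k) (inv x) \<otimes> inv k"
    using g c by (simp add: conj_by_def word_simps)
  moreover have "conj_by (inv k) (inv x) \<in> U" using normalizesD[OF n] c by blast
  ultimately show "inv g \<in> U <#> K" using c by (auto simp: set_mult_def)
  fix h assume "h \<in> U <#> K"
  then obtain y l where h: "y \<in> U" "l \<in> K" "h = y \<otimes> l" by (auto simp: set_mult_def)
  have d: "y \<in> carrier G" "l \<in> carrier G"
    using h assms by (auto simp: subgroup.mem_carrier)
  have "g \<otimes> h = (x \<otimes> conj_by k y) \<otimes> (k \<otimes> l)"
    using g h c d by (simp add: conj_by_def word_simps)
  moreover have "x \<otimes> conj_by k y \<in> U" "k \<otimes> l \<in> K"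
    using normalizesD[OF n] g h assms by (auto simp: subgroup.m_closed)
  ultimately show "g \<otimes> h \<in> U <#> K" by (auto simp: set_mult_def)
qed

lemma subset_set_mult_left: "subgroup K G \<Longrightarrow> U \<subseteq> carrier G \<Longrightarrow> U \<subseteq> U <#> K"
  by (force simp: set_mult_def dest: subgroup.one_closed)

lemma subset_set_mult_right: "subgroup U G \<Longrightarrow> K \<subseteq> carrier G \<Longrightarrow> K \<subseteq> U <#> K"
  by (force simp: set_mult_def dest: subgroup.one_closed)

text \<open>
  The commutator of an element of \<open>A\<close> with an element of \<open>B\<close> lies in \<open>A \<inter> B\<close>.
\<close>

lemma commute_if_disjoint_normalizing:
  assumes "subgroup A G" "subgroup B G" "normalizes A B" "normalizes B A" "A \<inter> B = {\<one>}"
    and a: "a \<in> A" and b: "b \<in> B"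
  shows "a \<otimes> b = b \<otimes> a"
proof -
  have c: "a \<in> carrier G" "b \<in> carrier G" "inv a \<in> A" "inv b \<in> B"
    using assms by (auto simp: subgroup.mem_carrier subgroup.m_inv_closed)
  have "conj_by a b \<otimes> inv b \<in> B"
    using assms c by (simp add: normalizesD subgroup.m_closed)
  moreover have "conj_by a b \<otimes> inv b = a \<otimes> conj_by b (inv a)"
    using c by (simp add: conj_by_def word_simps)
  moreover have "a \<otimes> conj_by b (inv a) \<in> A"
    using assms c by (metis normalizesD subgroup.m_closed)
  ultimately have "conj_by a b \<otimes> inv b = \<one>" using assms(5) by auto
  then have "conj_by a b = b" using c by (metis conj_by_closed inv_closed inv_equality inv_inv)
  then show ?thesis using c by (simp add: conj_by_eq_iff_commute)
qed

lemma simple_group_subgroupI: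
  assumes T: "subgroup T G" and fin: "finite T" and ne: "T \<noteq> {\<one>}"
    and min: "\<And>S. subgroup S G \<Longrightarrow> S \<subseteq> T \<Longrightarrow> normalizes T S \<Longrightarrow> S = {\<one>} \<or> S = T"
  shows "simple_group (G\<lparr>carrier := T\<rparr>)"
proof -
  interpret T: group "G\<lparr>carrier := T\<rparr>" using T by (simp add: subgroup.subgroup_is_group is_group)
  show ?thesis
  proof
    have "card T > 1"
      using T fin ne by (metis One_nat_def Suc_lessI card_1_singletonE card_gt_0_iff empty_iff
          singletonD subgroup.one_closed)
    then show "1 < order (G\<lparr>carrier := T\<rparr>)" by (simp add: order_def)
  next
    fix S assume S: "S \<lhd> G\<lparr>carrier := T\<rparr>"
    then have "subgroup S (G\<lparr>carrier := T\<rparr>)" by (rule normal_imp_subgroup)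
    then have SG: "subgroup S G" and ST: "S \<subseteq> T"
      using T incl_subgroup subgroup.subset[of S "G\<lparr>carrier := T\<rparr>"] by auto
    have "normalizes T S"
      using normal.inv_op_closed2[OF S] T
      by (simp add: normalizes_def conj_by_def m_inv_consistent)
    then show "S = carrier (G\<lparr>carrier := T\<rparr>) \<or> S = {\<one>\<^bsub>G\<lparr>carrier := T\<rparr>\<^esub>}"
      using min[OF SG ST] by auto
  qed
qed

end

section \<open>Sylow subgroups and fixed-point-free automorphisms\<close>

text \<open>
  The moved points are the union of the orbits of length other than one, and these lengths divide
  \<open>q\<^sup>k\<close>. All uses of \<open>q\<close>-groups below go through this count.
\<close>

lemma (in group_action) prime_dvd_card_moved_points:
  fixes q :: nat
  assumes "Factorial_Ring.prime q" "order G = q ^ k" "finite E"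
  shows "q dvd card {x \<in> E. \<exists>g\<in>carrier G. \<phi> g x \<noteq> x}"
proof -
  define C where "C = {R \<in> orbits G E \<phi>. \<exists>x\<in>R. \<exists>g\<in>carrier G. \<phi> g x \<noteq> x}"
  have moved: "{x \<in> E. \<exists>g\<in>carrier G. \<phi> g x \<noteq> x} = \<Union>C"
  proof (intro equalityI subsetI)
    fix x assume "x \<in> {x \<in> E. \<exists>g\<in>carrier G. \<phi> g x \<noteq> x}"
    then show "x \<in> \<Union>C"
      using orbit_refl unfolding C_def orbits_def by blast
  next
    fix x assume "x \<in> \<Union>C"
    then obtain y z g where y: "y \<in> E" "x \<in> orbit G \<phi> y" "z \<in> orbit G \<phi> y"
      and g: "g \<in> carrier G" "\<phi> g z \<noteq> z"
      unfolding C_def orbits_def by blast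
    have E: "x \<in> E" "z \<in> E"
      using y element_image unfolding orbit_def by blast+
    then have "z \<in> orbit G \<phi> x"
      using y orbit_sym orbit_trans by meson
    then obtain h where "h \<in> carrier G" "\<phi> h x = z" unfolding orbit_def by blast
    then have "\<exists>g\<in>carrier G. \<phi> g x \<noteq> x" using g by metis
    then show "x \<in> {x \<in> E. \<exists>g\<in>carrier G. \<phi> g x \<noteq> x}" using E by blast
  qed
  have fin: "finite (\<Union>C)"
    using assms(3) by (simp flip: moved)
  have "q dvd card R" if R: "R \<in> C" for R
  proof -
    obtain x z g where x: "x \<in> E" "R = orbit G \<phi> x" "z \<in> R" "g \<in> carrier G" "\<phi> g z \<noteq> z"
      using R unfolding C_def orbits_def by blast
    have "z \<in> E" using x element_image unfolding orbit_def by blast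
    have "card R dvd q ^ k"
      using orbit_stabilizer_theorem[OF x(1)] assms(2) x(2) by (metis dvd_triv_left)
    moreover have "card R \<noteq> 1"
    proof
      assume "card R = 1"
      then obtain w where "R = {w}" by (auto simp: card_1_singleton_iff)
      moreover have "\<phi> g z \<in> orbit G \<phi> z" using x(4) unfolding orbit_def by blast
      then have "\<phi> g z \<in> R"
        using x orbit_trans[OF x(1) \<open>z \<in> E\<close>] element_image[OF x(4) \<open>z \<in> E\<close>] by blast
      ultimately show False using x by auto
    qed
    ultimately show ?thesis
      using divides_primepow_nat[OF assms(1)]
      by (metis One_nat_def dvd_power gr0I power_0)
  qed
  then show ?thesis
    unfolding moved using fin disjoint_union
    by (intro dvd_partition) (auto simp: C_def)
qed

context group
begin

text \<open>
  The group acts on itself by conjugation, and the fixed points are the central elements. If \<open>\<one>\<close> were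
  the only one, \<open>q\<close> would divide both the order of the group and its predecessor.
\<close>

lemma p_group_center_nontrivial:
  fixes q :: nat
  assumes q: "Factorial_Ring.prime q" and order: "order G = q ^ k" and ne: "carrier G \<noteq> {\<one>}"
  shows "\<exists>z\<in>carrier G. z \<noteq> \<one> \<and> (\<forall>g\<in>carrier G. g \<otimes> z = z \<otimes> g)"
proof (rule ccontr)
  assume no: "\<not> ?thesis"
  interpret act: group_action G "carrier G" "\<lambda>g. \<lambda>h\<in>carrier G. g \<otimes> h \<otimes> inv g"
    by (rule action_by_conjugation)
  have fin: "finite (carrier G)"
    using order_gt_0_iff_finite order q by (metis prime_gt_0_nat zero_less_power)
  have "k \<noteq> 0"
    using order ne order_one_triv_iff by auto
  then have "q dvd card (carrier G)"
    using order by (simp add: order_def)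
  moreover have "{x \<in> carrier G. \<exists>g\<in>carrier G. (\<lambda>h\<in>carrier G. g \<otimes> h \<otimes> inv g) x \<noteq> x} = carrier G - {\<one>}"
    using no conj_by_eq_iff_commute by (auto simp: conj_by_def)
  then have "q dvd card (carrier G - {\<one>})"
    using act.prime_dvd_card_moved_points[OF q order fin] by simp
  ultimately have "q dvd card (carrier G) - card (carrier G - {\<one>})"
    by (rule dvd_diff_nat)
  moreover have "card (carrier G) - card (carrier G - {\<one>}) = 1"
    using card_Suc_Diff1[OF fin one_closed] by linarith
  ultimately show False using q by simp
qed

lemma right_cosets_action:
  assumes Q: "subgroup Q G"
  shows "group_action G (rcosets Q) (\<lambda>g. \<lambda>C\<in>rcosets Q. C #> inv g)"
proof -
  have sub: "C \<subseteq> carrier G" if "C \<in> rcosets Q" for C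
    using that Q by (simp add: subgroup.rcosets_carrier is_group)
  have cl: "C #> g \<in> rcosets Q" if "C \<in> rcosets Q" "g \<in> carrier G" for C g
    using that Q by (auto simp: RCOSETS_def coset_mult_assoc subgroup.subset)
  have bij: "(\<lambda>C\<in>rcosets Q. C #> inv g) \<in> Bij (rcosets Q)" if g: "g \<in> carrier G" for g
  proof -
    have "bij_betw (\<lambda>C. C #> inv g) (rcosets Q) (rcosets Q)"
      by (rule bij_betw_byWitness[where f' = "\<lambda>C. C #> g"])
        (use g cl sub in \<open>auto simp: coset_mult_assoc\<close>)
    then show ?thesis by (simp add: Bij_def cong: bij_betw_cong)
  qed
  have "(\<lambda>g. \<lambda>C\<in>rcosets Q. C #> inv g) \<in> hom G (BijGroup (rcosets Q))"
  proof (rule homI)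
    fix g h assume gh: "g \<in> carrier G" "h \<in> carrier G"
    show "(\<lambda>C\<in>rcosets Q. C #> inv (g \<otimes> h)) =
        (\<lambda>C\<in>rcosets Q. C #> inv g) \<otimes>\<^bsub>BijGroup (rcosets Q)\<^esub> (\<lambda>C\<in>rcosets Q. C #> inv h)"
      using gh cl sub
      by (auto simp: BijGroup_def bij compose_def coset_mult_assoc inv_mult_group intro!: restrict_ext)
  qed (simp add: BijGroup_def bij)
  then show ?thesis
    by (simp add: group_action_def group_hom_def group_hom_axioms_def group_BijGroup is_group)
qed

text \<open>
  The \<open>q\<close>-subgroup \<open>P\<close> acts on the cosets of \<open>Q\<close> by right multiplication. Their number is prime to \<open>q\<close>,
  so some coset \<open>Q g\<close> is fixed, which means that \<open>g P g\<^sup>-\<^sup>1\<close> is contained in \<open>Q\<close>.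
\<close>

lemma p_subgroup_conjugate_into_sylow:
  fixes q :: nat
  assumes fin: "finite (carrier G)" and q: "Factorial_Ring.prime q"
    and P: "subgroup P G" "card P = q ^ k" and Q: "subgroup Q G" "\<not> q dvd card (rcosets Q)"
  shows "\<exists>g\<in>carrier G. conj_by g ` P \<subseteq> Q"
proof -
  interpret act: group_action "G\<lparr>carrier := P\<rparr>" "rcosets Q" "\<lambda>g. \<lambda>C\<in>rcosets Q. C #> inv g"
    using right_cosets_action[OF Q(1)] P(1) by (rule group_action.induced_action)
  let ?M = "{C \<in> rcosets Q. \<exists>g\<in>P. (\<lambda>C\<in>rcosets Q. C #> inv g) C \<noteq> C}"
  have "finite (rcosets Q)"
    using fin Q(1) by (simp add: rcosets_finite subgroup.subset RCOSETS_def)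
  then have "q dvd card ?M"
    using act.prime_dvd_card_moved_points[OF q, of k] P(2) by (simp add: order_def)
  then have "?M \<noteq> rcosets Q" using Q(2) by metis
  then obtain C where C: "C \<in> rcosets Q" "C \<notin> ?M" by blast
  then have fixed: "\<forall>x\<in>P. C #> inv x = C" by auto
  obtain g where g: "g \<in> carrier G" "C = Q #> g" using C by (auto simp: RCOSETS_def)
  have "conj_by g x \<in> Q" if x: "x \<in> P" for x
  proof -
    have "inv x \<in> P" "x \<in> carrier G" 
      using x P(1) by (simp_all add: subgroup.m_inv_closed subgroup.mem_carrier)
    then have "Q #> g #> x = Q #> g" using fixed g(2) by (metis inv_inv)
    moreover have "g \<otimes> x \<in> Q #> g #> x"
      using g Q(1) \<open>x \<in> carrier G\<close>
      by (simp add: coset_mult_assoc subgroup.subset rcos_self)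
    ultimately have "g \<otimes> x \<in> Q #> g" by simp
    then obtain y where "y \<in> Q" "g \<otimes> x = y \<otimes> g" by (auto simp: r_coset_def)
    moreover then have "conj_by g x = y"
      using g \<open>x \<in> carrier G\<close> Q(1)
      by (simp add: conj_by_def word_simps subgroup.mem_carrier)
    ultimately show ?thesis by simp
  qed
  then show ?thesis using g(1) by blast
qed

definition sylow_subgroups :: "nat \<Rightarrow> 'a set \<Rightarrow> 'a set set" where
  "sylow_subgroups q N =
     {Q. subgroup Q G \<and> Q \<subseteq> N \<and> card Q = q ^ multiplicity q (card N)}"

lemma sylow_subgroups_nonempty:
  assumes "subgroup N G" "finite N" "Factorial_Ring.prime q"
  shows "sylow_subgroups q N \<noteq> {}"
proof -
  obtain m where "card N = q ^ multiplicity q (card N) * m"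
    using multiplicity_dvd by (meson dvdE)
  then obtain Q where Q: "subgroup Q (G\<lparr>carrier := N\<rparr>)" "card Q = q ^ multiplicity q (card N)"
    using sylow_thm[of q "G\<lparr>carrier := N\<rparr>" "multiplicity q (card N)" m] assms
    by (auto simp: order_def subgroup_imp_group)
  then have "Q \<in> sylow_subgroups q N"
    using incl_subgroup[OF assms(1)] subgroup.subset[OF Q(1)] by (auto simp: sylow_subgroups_def)
  then show ?thesis by blast
qed

lemma sylow_subgroups_conjugate:
  assumes N: "subgroup N G" "finite N" and q: "Factorial_Ring.prime q"
    and P: "P \<in> sylow_subgroups q N" and Q: "Q \<in> sylow_subgroups q N"
  shows "\<exists>g\<in>N. conj_by g ` P = Q"
proof -
  interpret N: group "G\<lparr>carrier := N\<rparr>" using N(1) by (rule subgroup_imp_group)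
  have sub: "subgroup P (G\<lparr>carrier := N\<rparr>)" "subgroup Q (G\<lparr>carrier := N\<rparr>)"
    using P Q N by (auto simp: sylow_subgroups_def subgroup_incl)
  have card: "card P = q ^ multiplicity q (card N)" "card Q = q ^ multiplicity q (card N)"
    using P Q by (auto simp: sylow_subgroups_def)
  have pos: "card N \<noteq> 0"
    using N by (metis card_eq_0_iff empty_iff subgroup.one_closed)
  have "card (rcosets\<^bsub>G\<lparr>carrier := N\<rparr>\<^esub> Q) * q ^ multiplicity q (card N) = card N"
    using N.lagrange[OF sub(2)] card(2) by (simp add: order_def)
  then have "\<not> q dvd card (rcosets\<^bsub>G\<lparr>carrier := N\<rparr>\<^esub> Q)"
    using multiplicity_decompose[of "card N" q] pos q
    by (metis (no_types, lifting) mult.commute mult_dvd_mono dvd_refl multiplicity_decompose'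
        not_prime_unit power_Suc2 power_dvd_iff_le_multiplicity not_less_eq_eq order_refl)
  then obtain g where g: "g \<in> N" "N.conj_by g ` P \<subseteq> Q"
    using N.p_subgroup_conjugate_into_sylow[OF _ q sub(1) card(1) sub(2)] N(2) by auto
  have "N.conj_by g x = conj_by g x" for x
    using g N(1) by (simp add: N.conj_by_def conj_by_def m_inv_consistent)
  then have "conj_by g ` P \<subseteq> Q" using g by simp
  moreover have "finite Q" 
    using Q N(2) by (auto simp: sylow_subgroups_def intro: finite_subset)
  moreover have "card (conj_by g ` P) = card Q"
    using P g N card by (subst card_conj_image) (auto simp: sylow_subgroups_def subgroup.mem_carrier)
  ultimately show ?thesis using g card_subset_eq by blast
qed

text \<open>
  The finite analogue of Lang's theorem: \<open>m \<mapsto> m\<^sup>-\<^sup>1 m\<^sup>a\<close> identifies \<open>m\<close> and \<open>n\<close> only if \<open>m n\<^sup>-\<^sup>1\<close> is fixed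
  by \<open>a\<close>, so on a finite group without nontrivial fixed points it is a bijection.
\<close>

lemma fixed_point_free_lang:
  assumes N: "subgroup N G" "finite N" and a: "a \<in> carrier G" "normalizes {a} N"
    and free: "\<And>x. x \<in> N \<Longrightarrow> conj_by a x = x \<Longrightarrow> x = \<one>"
    and g: "g \<in> N"
  shows "\<exists>!m. m \<in> N \<and> inv m \<otimes> conj_by a m = g"
proof -
  have cl: "m \<in> N \<Longrightarrow> m \<in> carrier G \<and> inv m \<in> N \<and> conj_by a m \<in> N" for m
    using N a by (auto simp: subgroup.mem_carrier subgroup.m_inv_closed normalizes_def)
  have inj: "inj_on (\<lambda>m. inv m \<otimes> conj_by a m) N"
  proof (rule inj_onI)
    fix m n assume mn: "m \<in> N" "n \<in> N" and eq: "inv m \<otimes> conj_by a m = inv n \<otimes> conj_by a n"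
    note c = cl[OF mn(1)] cl[OF mn(2)] a(1)
    have "conj_by a m = m \<otimes> (inv m \<otimes> conj_by a m)"
      using c by (simp add: word_simps)
    also have "\<dots> = m \<otimes> inv n \<otimes> conj_by a n"
      using c eq by (simp add: word_simps)
    finally have "conj_by a (m \<otimes> inv n) = m \<otimes> inv n"
      using c by (simp add: conj_by_mult word_simps)
    then have "m \<otimes> inv n = \<one>"
      using c N(1) mn(1) by (intro free) (auto simp: subgroup.m_closed)
    then have "m \<otimes> inv n \<otimes> n = n" using c by simp
    then show "m = n" using c by (simp add: word_simps)
  qed
  have "(\<lambda>m. inv m \<otimes> conj_by a m) ` N \<subseteq> N"
    using cl subgroup.m_closed[OF N(1)] by blast
  then have "(\<lambda>m. inv m \<otimes> conj_by a m) ` N = N"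
    using N(2) inj by (intro endo_inj_surj)
  then have "g \<in> (\<lambda>m. inv m \<otimes> conj_by a m) ` N" using g by simp
  then show ?thesis by (rule imageE) (use inj in \<open>auto simp: inj_on_def\<close>)
qed

text \<open>
  Existence: for a Sylow subgroup \<open>P\<close>, conjugacy gives \<open>g\<close> in \<open>N\<close> carrying \<open>P\<^sup>a\<close> back to \<open>P\<close>. The conjugate
  of \<open>P\<close> by \<open>y\<close> is invariant under \<open>a\<close> as soon as \<open>y\<^sup>-\<^sup>1 y\<^sup>a = g\<close>, which has a solution.

  Uniqueness: if \<open>Q\<close> and its conjugate by \<open>g\<close> are both invariant, then \<open>g\<^sup>-\<^sup>1 g\<^sup>a\<close> normalises \<open>Q\<close>. The
  normaliser of \<open>Q\<close> in \<open>N\<close> is itself \<open>a\<close>-invariant, so it contains a solution \<open>m\<close> of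
  \<open>m\<^sup>-\<^sup>1 m\<^sup>a = g\<^sup>-\<^sup>1 g\<^sup>a\<close>; the solution in \<open>N\<close> being unique, \<open>g = m\<close> normalises \<open>Q\<close>.
\<close>

lemma ex1_fixed_point_free_sylow:
  assumes N: "subgroup N G" "finite N" and a: "a \<in> carrier G" "normalizes {a} N"
    and free: "\<And>x. x \<in> N \<Longrightarrow> conj_by a x = x \<Longrightarrow> x = \<one>"
    and q: "Factorial_Ring.prime q"
  shows "\<exists>!Q. Q \<in> sylow_subgroups q N \<and> normalizes {a} Q"
proof (rule ex_ex1I)
  have NG: "N \<subseteq> carrier G" using N(1) by (rule subgroup.subset)
  have conj_N: "conj_by g ` Q \<in> sylow_subgroups q N"
    if "Q \<in> sylow_subgroups q N" "g \<in> carrier G" "normalizes {g} N" for g Q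
    using that N by (auto simp: sylow_subgroups_def subgroup_conj_image card_conj_image
        subgroup.subset normalizes_def)
  obtain P where P: "P \<in> sylow_subgroups q N"
    using sylow_subgroups_nonempty[OF N q] by blast
  have PN: "P \<subseteq> N" "subgroup P G" using P by (auto simp: sylow_subgroups_def)
  obtain g where g: "g \<in> N" "conj_by g ` (conj_by a ` P) = P"
    using sylow_subgroups_conjugate[OF N q conj_N[OF P a] P] by blast
  have "\<exists>!y. y \<in> N \<and> inv y \<otimes> conj_by a y = g"
    by (rule fixed_point_free_lang[OF N a _ g(1)]) (rule free)
  then obtain y where y: "y \<in> N" "inv y \<otimes> conj_by a y = g" by blast
  have c: "g \<in> carrier G" "y \<in> carrier G" using g y NG by auto
  have yn: "normalizes {y} N"
    using normalizes_subgroup[OF N(1)] y by (auto simp: normalizes_def)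
  have "conj_by a (conj_by y x) \<in> conj_by y ` P" if x: "x \<in> P" for x
  proof -
    have xG: "x \<in> carrier G" using x PN NG by auto
    have "conj_by a (conj_by y x) = conj_by (conj_by a y) (conj_by a x)"
      using xG c a by (simp add: conj_by_def word_simps)
    also have "conj_by a y = y \<otimes> g"
      using c a by (simp flip: y(2) add: word_simps)
    finally have "conj_by a (conj_by y x) = conj_by y (conj_by g (conj_by a x))"
      using xG c a by (simp add: conj_by_conj_by)
    then show ?thesis using g(2) x by blast
  qed
  then have "normalizes {a} (conj_by y ` P)" by (auto simp: normalizes_def)
  then show "\<exists>Q. Q \<in> sylow_subgroups q N \<and> normalizes {a} Q"
    using conj_N[OF P c(2) yn] by blast
next
  have NG: "N \<subseteq> carrier G" using N(1) by (rule subgroup.subset)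
  fix Q Q' assume Q: "Q \<in> sylow_subgroups q N \<and> normalizes {a} Q"
    and Q': "Q' \<in> sylow_subgroups q N \<and> normalizes {a} Q'"
  have QN: "Q \<subseteq> N" "finite Q" "Q \<subseteq> carrier G" using Q NG N(2)
    by (auto simp: sylow_subgroups_def intro: finite_subset)
  obtain g where g: "g \<in> N" "conj_by g ` Q = Q'"
    using sylow_subgroups_conjugate[OF N q] Q Q' by blast
  have aQ: "conj_by a ` Q = Q"
    using Q QN a by (intro conj_image_eq) (auto simp: normalizes_def)
  \<comment> \<open>The normaliser of \<open>Q\<close> in \<open>N\<close>.\<close>
  define M where "M = {n \<in> N. normalizes {n} Q}"
  have "subgroup M G"
  proof (rule subgroupI)
    show "M \<subseteq> carrier G" using NG by (auto simp: M_def)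
    have "\<one> \<in> M" using N(1) QN by (auto simp: M_def normalizes_def subgroup.one_closed subset_iff)
    then show "M \<noteq> {}" by blast
  qed (use N(1) NG QN in \<open>auto simp: M_def subgroup.m_inv_closed subgroup.m_closed normalizes_inv\<close>,
       auto simp: normalizes_def conj_by_conj_by subset_iff)
  moreover have "conj_by a n \<in> M" if n: "n \<in> M" for n
  proof -
    have "conj_by (conj_by a n) x \<in> Q" if x: "x \<in> Q" for x
    proof -
      obtain z where z: "z \<in> Q" "x = conj_by a z" using aQ x by blast
      have "z \<in> carrier G" "n \<in> carrier G" using z n QN NG by (auto simp: M_def)
      then have "conj_by (conj_by a n) x = conj_by a (conj_by n z)"
        using a z(2) by (simp add: conj_by_def word_simps)
      then show ?thesis using n z Q by (auto simp: M_def normalizes_def)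
    qed
    moreover have "conj_by a n \<in> N" using a n by (auto simp: M_def normalizes_def)
    ultimately show ?thesis by (simp add: M_def normalizes_def)
  qed
  ultimately have langM: "\<exists>!m. m \<in> M \<and> inv m \<otimes> conj_by a m = n" if "n \<in> M" for n
    using that free N(2) a(1)
    by (intro fixed_point_free_lang) (auto simp: M_def normalizes_def)
  define n where "n = inv g \<otimes> conj_by a g"
  have gG: "g \<in> carrier G" using g NG by auto
  have "conj_by n x \<in> Q" if x: "x \<in> Q" for x
  proof -
    obtain z where z: "z \<in> Q" "x = conj_by a z" using aQ x by blast
    have zG: "z \<in> carrier G" using z QN by auto
    have "conj_by a (conj_by g z) \<in> Q'"
      using g z Q' by (auto simp: normalizes_def)
    then obtain w where w: "w \<in> Q" "conj_by a (conj_by g z) = conj_by g w" using g by blast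
    have "conj_by n x = conj_by (inv g) (conj_by a (conj_by g z))"
      using zG gG a by (simp add: z(2) n_def conj_by_def word_simps)
    also have "\<dots> = w" using w gG QN by auto
    finally show ?thesis using w by simp
  qed
  moreover have "n \<in> N"
    using g a N(1) by (simp add: n_def normalizes_def subgroup.m_closed subgroup.m_inv_closed)
  ultimately have "n \<in> M" by (simp add: M_def normalizes_def)
  then obtain m where m: "m \<in> M" "inv m \<otimes> conj_by a m = n"
    using langM by blast
  have "\<exists>!m. m \<in> N \<and> inv m \<otimes> conj_by a m = n"
    by (rule fixed_point_free_lang[OF N a _ \<open>n \<in> N\<close>]) (rule free)
  then have "m = g"
    using g(1) m n_def by (auto simp: M_def)
  then show "Q = Q'"
    using m g QN gG conj_image_eq[of Q g] by (auto simp: M_def normalizes_def)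
qed

end

section \<open>Two conditions that no non-abelian simple group satisfies\<close>

context group
begin

lemma commute_involutions:
  assumes "u \<in> carrier G" "v \<in> carrier G" "u \<otimes> u = \<one>" "v \<otimes> v = \<one>"
    and "(u \<otimes> v) \<otimes> (u \<otimes> v) = \<one>"
  shows "u \<otimes> v = v \<otimes> u"
  using assms by (metis inv_equality inv_mult_group m_closed)

text \<open>
  The conjugacy class \<open>I\<close> of \<open>t\<close> consists of half of the elements; let \<open>K\<close> be the other half. If \<open>u\<close>, \<open>v\<close>
  and \<open>u v\<close> were all in \<open>I\<close>, the involutions \<open>u\<close> and \<open>v\<close> would commute, hence be equal since
  \<open>C(u) = {1, u}\<close>, and their product would be \<open>1\<close>. So products of two elements of \<open>I\<close> lie in \<open>K\<close>, and by counting \<open>t I = I t = K\<close>.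
  Therefore \<open>K K = (I t) (t I) = I I \<subseteq> K\<close>.
\<close>

lemma self_centralizing_involution:
  assumes fin: "finite (carrier G)" and t: "t \<in> carrier G" "t \<noteq> \<one>" "t \<otimes> t = \<one>"
    and cent: "\<And>x. x \<in> carrier G \<Longrightarrow> t \<otimes> x = x \<otimes> t \<Longrightarrow> x = \<one> \<or> x = t"
  shows "\<exists>K. K \<lhd> G \<and> t \<notin> K \<and> order G = 2 * card K"
proof -
  define I where "I = (\<lambda>g. conj_by g t) ` carrier G"
  define K where "K = carrier G - I"
  have IG: "I \<subseteq> carrier G" and tI: "t \<in> I"
    using t by (auto simp: I_def image_iff intro!: bexI[of _ \<one>])
  have conjI: "conj_by g u \<in> I" if u: "u \<in> I" and g: "g \<in> carrier G" for u g
  proof -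
    obtain h where "h \<in> carrier G" "u = conj_by h t" using u by (auto simp: I_def)
    then show ?thesis using g t
      by (auto simp: I_def conj_by_conj_by[symmetric] intro!: imageI)
  qed
  have invol: "u \<otimes> u = \<one>" "u \<noteq> \<one>" if "u \<in> I" for u
    using that t by (auto simp: I_def conj_by_mult[symmetric])
  have centI: "x = \<one> \<or> x = u" if u: "u \<in> I" and x: "x \<in> carrier G" "u \<otimes> x = x \<otimes> u" for u x
  proof -
    obtain g where g: "g \<in> carrier G" "u = conj_by g t" using u by (auto simp: I_def)
    have uG: "u \<in> carrier G" using g t by simp
    have "conj_by (inv g) (u \<otimes> x) = conj_by (inv g) (x \<otimes> u)" using x by simp
    then have "t \<otimes> conj_by (inv g) x = conj_by (inv g) x \<otimes> t"
      using g t x by (simp add: conj_by_mult uG)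
    then have "conj_by (inv g) x = \<one> \<or> conj_by (inv g) x = t"
      using cent[of "conj_by (inv g) x"] g x by auto
    then show ?thesis
    proof
      assume "conj_by (inv g) x = t"
      then have "conj_by g t = conj_by g (conj_by (inv g) x)" by simp
      then show ?thesis using g x by simp
    qed (use g x in simp)
  qed
  have IIK: "u \<otimes> v \<in> K" if "u \<in> I" "v \<in> I" for u v
  proof (rule ccontr)
    have c: "u \<in> carrier G" "v \<in> carrier G" using that IG by auto
    assume "u \<otimes> v \<notin> K"
    then have uv: "u \<otimes> v \<in> I" using c by (simp add: K_def)
    then have "u \<otimes> v = v \<otimes> u"
      using that c invol by (intro commute_involutions) auto
    then have "v = u" using centI[OF that(1) c(2)] invol that by auto
    then show False using uv invol that by auto
  qed
  interpret act: group_action G "carrier G" "\<lambda>g. \<lambda>h\<in>carrier G. g \<otimes> h \<otimes> inv g"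
    by (rule action_by_conjugation)
  have "stabilizer G (\<lambda>g. \<lambda>h\<in>carrier G. g \<otimes> h \<otimes> inv g) t = {\<one>, t}"
  proof -
    have "g \<otimes> t \<otimes> inv g = t \<longleftrightarrow> g \<otimes> t = t \<otimes> g" if "g \<in> carrier G" for g
      using conj_by_eq_iff_commute[OF that t(1)] by (simp add: conj_by_def)
    moreover have "x = \<one> \<or> x = t" if "x \<in> carrier G" "x \<otimes> t = t \<otimes> x" for x
      using cent[OF that(1)] that(2) by simp
    ultimately show ?thesis using t(1) by (auto simp: stabilizer_def)
  qed
  moreover have "orbit G (\<lambda>g. \<lambda>h\<in>carrier G. g \<otimes> h \<otimes> inv g) t = I"
    using t(1) by (auto simp: orbit_def I_def conj_by_def)
  ultimately have ord: "order G = card I * 2"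
    using act.orbit_stabilizer_theorem[OF t(1)] t(2) by simp
  have fI: "finite I" "finite K" using fin IG by (auto simp: K_def intro: finite_subset)
  have cK: "card K = card I"
    using ord IG fI by (simp add: K_def card_Diff_subset order_def)
  have tK: "(\<lambda>v. t \<otimes> v) ` I = K"
    using IIK[OF tI] IG t(1) cK fI
    by (intro card_subset_eq) (auto simp: card_image inj_on_def subset_iff)
  have Kt: "(\<lambda>v. v \<otimes> t) ` I = K"
    using IIK[OF _ tI] IG t(1) cK fI
    by (intro card_subset_eq) (auto simp: card_image inj_on_def subset_iff)
  have "subgroup K G"
  proof (rule subgroupI)
    show "K \<subseteq> carrier G" by (auto simp: K_def)
    show "K \<noteq> {}" using tK tI by blast
    fix k assume k: "k \<in> K"
    then obtain v where v: "v \<in> I" "k = v \<otimes> t" using Kt by blast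
    have vG: "v \<in> carrier G" using v IG by auto
    have "inv k = t \<otimes> v"
      using invol[OF v(1)] v t vG by (metis inv_equality inv_mult_group)
    then show "inv k \<in> K" using IIK[OF tI v(1)] by simp
    fix l assume "l \<in> K"
    then obtain w where w: "w \<in> I" "l = t \<otimes> w" using tK by blast
    have wG: "w \<in> carrier G" using w IG by auto
    have "k \<otimes> l = v \<otimes> (t \<otimes> t) \<otimes> w"
      using v w vG wG t(1) by (simp add: m_assoc)
    then have "k \<otimes> l = v \<otimes> w" using t vG by simp
    then show "k \<otimes> l \<in> K" using IIK v w by simp
  qed
  moreover have "conj_by g k \<in> K" if "g \<in> carrier G" "k \<in> K" for g k
  proof -
    have k: "k \<in> carrier G" "k \<notin> I" using that by (auto simp: K_def)
    have "conj_by g k \<notin> I"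
      using conjI[of "conj_by g k" "inv g"] that k by auto
    then show ?thesis using that k by (simp add: K_def)
  qed
  ultimately have "K \<lhd> G" by (simp add: normal_iff_normalizes normalizes_def)
  moreover have "t \<notin> K" using tI by (simp add: K_def)
  ultimately show ?thesis using ord cK by auto
qed

end

context simple_group
begin

lemma no_self_centralizing_involution:
  assumes "finite (carrier G)" "\<not> comm_group G" "t \<in> carrier G" "t \<noteq> \<one>" "t \<otimes> t = \<one>"
  shows "\<exists>x\<in>carrier G. t \<otimes> x = x \<otimes> t \<and> x \<noteq> \<one> \<and> x \<noteq> t"
proof (rule ccontr)
  assume "\<not> ?thesis"
  then obtain K where K: "K \<lhd> G" "t \<notin> K" "order G = 2 * card K"
    using self_centralizing_involution[of t] assms by blast
  then have "order G = 2"
    using no_real_normal_subgroup[OF K(1)] assms(3) by auto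
  then have "carrier G = {\<one>, t}"
    using assms by (intro sym[OF card_subset_eq]) (auto simp: order_def)
  then have "comm_group G"
    by (intro group_comm_groupI) (use assms in auto)
  with assms show False by simp
qed

text \<open>
  Let \<open>S\<close> be the set of squares. It is contained in its centraliser, which is normal. If this centraliser
  is trivial, or if the squares are central in a group with trivial centre, then every square is
  trivial and the group is abelian. In the remaining case the centre is the whole group.
\<close>

lemma comm_group_if_squares_commute:
  assumes sq: "\<And>x y. x \<in> carrier G \<Longrightarrow> y \<in> carrier G \<Longrightarrow>
      (x \<otimes> x) \<otimes> (y \<otimes> y) = (y \<otimes> y) \<otimes> (x \<otimes> x)"
  shows "comm_group G"
proof -
  define S where "S = (\<lambda>x. x \<otimes> x) ` carrier G"
  have SG: "S \<subseteq> carrier G" by (auto simp: S_def)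
  have "normalizes (carrier G) S"
    by (auto simp: S_def normalizes_def conj_by_mult)
  then have "centralizer S \<lhd> G"
    using normalizes_centralizer[OF subgroup_self SG] subgroup_centralizer[OF SG]
    by (simp add: normal_iff_normalizes)
  then have "centralizer S = carrier G \<or> centralizer S = {\<one>}"
    by (rule no_real_normal_subgroup)
  moreover have "S \<subseteq> centralizer S" using sq by (auto simp: centralizer_def S_def)
  moreover have "centralizer (carrier G) \<lhd> G"
    using normalizes_centralizer[OF subgroup_self] subgroup_centralizer[of "carrier G"]
    by (auto simp: normal_iff_normalizes normalizes_def)
  then have "centralizer (carrier G) = carrier G \<or> centralizer (carrier G) = {\<one>}"
    by (rule no_real_normal_subgroup)
  moreover have "S \<subseteq> centralizer (carrier G)" if "centralizer S = carrier G"
  proof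
    fix s assume s: "s \<in> S"
    have "g \<otimes> s = s \<otimes> g" if "g \<in> carrier G" for g
      using that s \<open>centralizer S = carrier G\<close> by (auto simp: centralizer_def set_eq_iff)
    then show "s \<in> centralizer (carrier G)" using s SG by (auto simp: centralizer_def)
  qed
  ultimately consider "centralizer (carrier G) = carrier G" | "S \<subseteq> {\<one>}" by blast
  then show ?thesis
  proof cases
    case 1
    then show ?thesis
      by (intro group_comm_groupI) (auto simp: centralizer_def set_eq_iff)
  next
    case 2
    then have "x \<otimes> x = \<one>" if "x \<in> carrier G" for x
      using that by (auto simp: S_def)
    then show ?thesis
      by (intro group_comm_groupI commute_involutions) auto
  qed
qed

end

section \<open>Minimal invariant subgroups\<close>

context group
begin

text \<open>
  For \<open>K = G\<close> these are the minimal normal subgroups of \<open>G\<close>, and for a subgroup \<open>K\<close> that contains \<open>T\<close>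
  the minimal normal subgroups of \<open>K\<close>.
\<close>

definition minimal_normalized :: "'a set \<Rightarrow> 'a set \<Rightarrow> bool" where
  "minimal_normalized K T \<longleftrightarrow> subgroup T G \<and> T \<noteq> {\<one>} \<and> normalizes K T \<and>
     (\<forall>S. subgroup S G \<and> S \<subseteq> T \<and> normalizes K S \<longrightarrow> S = {\<one>} \<or> S = T)"

lemma exists_minimal_normalized:
  assumes "finite N" "subgroup N G" "N \<noteq> {\<one>}" "normalizes K N"
  shows "\<exists>T\<subseteq>N. minimal_normalized K T"
proof -
  define F where "F = {S. subgroup S G \<and> S \<subseteq> N \<and> S \<noteq> {\<one>} \<and> normalizes K S}"
  have "finite F" using assms(1) by (auto simp: F_def intro: finite_subset[of _ "Pow N"])
  moreover have "N \<in> F" using assms by (simp add: F_def)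
  ultimately obtain T where T: "T \<in> F" and min: "\<And>S. S \<in> F \<Longrightarrow> S \<subseteq> T \<Longrightarrow> S = T"
    using finite_has_minimal[of F] by (metis empty_iff)
  have "minimal_normalized K T"
    using T min by (fastforce simp: minimal_normalized_def F_def)
  then show ?thesis using T by (auto simp: F_def)
qed

lemma minimal_normalized_cases:
  assumes "minimal_normalized K T" "subgroup S G" "S \<subseteq> T" "normalizes K S"
  obtains "S = {\<one>}" | "S = T"
  using assms by (auto simp: minimal_normalized_def)

lemma conj_by_pow:
  fixes n :: nat
  assumes "g \<in> carrier G" "x \<in> carrier G"
  shows "conj_by g x [^] n = conj_by g (x [^] n)"
  using assms by (induction n) (simp_all add: conj_by_mult)

text \<open>
  For a prime \<open>p\<close> dividing the order of some element, the elements of order dividing \<open>p\<close> form a nontrivial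
  subgroup which is invariant under all automorphisms.
\<close>

lemma minimal_normal_commutative_exponent:
  assumes fin: "finite (carrier G)" and N: "minimal_normalized (carrier G) N"
    and comm: "\<And>x y. x \<in> N \<Longrightarrow> y \<in> N \<Longrightarrow> x \<otimes> y = y \<otimes> x"
  shows "\<exists>p::nat. Factorial_Ring.prime p \<and> (\<forall>x\<in>N. x [^] p = \<one>)"
proof -
  have sub: "subgroup N G" and ne: "N \<noteq> {\<one>}" using N by (auto simp: minimal_normalized_def)
  then obtain x where x: "x \<in> N" "x \<noteq> \<one>" using subgroup.one_closed by blast
  have xG: "x \<in> carrier G" using x sub by (simp add: subgroup.mem_carrier)
  have "ord x \<noteq> 1" using x xG ord_eq_1 by simp
  then obtain p where p: "Factorial_Ring.prime p" "p dvd ord x"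
    using prime_factor_nat by blast
  then obtain m where m: "ord x = p * m" by blast
  define S where "S = {x \<in> N. x [^] p = \<one>}"
  have "subgroup S G"
  proof (rule subgroupI)
    show "S \<subseteq> carrier G" using sub by (auto simp: S_def subgroup.mem_carrier)
    have "\<one> \<in> S" using sub by (simp add: S_def subgroup.one_closed)
    then show "S \<noteq> {}" by blast
    fix y assume y: "y \<in> S"
    then have yG: "y \<in> carrier G" using sub by (simp add: S_def subgroup.mem_carrier)
    show "inv y \<in> S" using y yG sub by (simp add: S_def subgroup.m_inv_closed nat_pow_inv)
    fix z assume z: "z \<in> S"
    then have zG: "z \<in> carrier G" using sub by (simp add: S_def subgroup.mem_carrier)
    show "y \<otimes> z \<in> S"
      using y z yG zG sub comm by (simp add: S_def subgroup.m_closed pow_mult_distrib)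
  qed
  moreover have "normalizes (carrier G) S"
    using N sub unfolding S_def minimal_normalized_def normalizes_def
    by (auto simp: conj_by_pow subgroup.mem_carrier)
  moreover have "S \<subseteq> N" by (auto simp: S_def)
  ultimately consider "S = {\<one>}" | "S = N" using N minimal_normalized_cases by metis
  then have "S = N"
  proof cases
    case 1
    have "x [^] m \<in> N"
      using x sub by (induction m) (auto simp: subgroup.one_closed subgroup.m_closed)
    moreover have "(x [^] m) [^] p = \<one>"
      using xG m by (simp add: nat_pow_pow mult.commute flip: pow_ord_eq_1)
    ultimately have "x [^] m = \<one>" using 1 by (auto simp: S_def)
    then have "p * m dvd m" using xG m pow_eq_id by simp
    moreover have "m \<noteq> 0"
      using ord_ge_1[OF fin xG] m by auto
    ultimately show ?thesis using p(1) by (auto dest: dvd_imp_le simp: prime_nat_iff)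
  qed
  then show ?thesis using p(1) by (auto simp: S_def)
qed

lemma normal_minimal_normalized: "minimal_normalized (carrier G) N \<Longrightarrow> N \<lhd> G"
  by (simp add: minimal_normalized_def normal_iff_normalizes)

end

section \<open>Core-free maximal subgroups\<close>

text \<open>
  The point stabilisers of a finite primitive permutation group, described without the set on which the
  group acts.
\<close>

locale core_free_maximal_subgroup = group +
  fixes H
  assumes finite_carrier: "finite (carrier G)"
    and subgroup_H: "subgroup H G"
    and maximal: "\<And>K. subgroup K G \<Longrightarrow> H \<subseteq> K \<Longrightarrow> K = H \<or> K = carrier G"
    and core_free: "\<And>N. N \<lhd> G \<Longrightarrow> N \<subseteq> H \<Longrightarrow> N = {\<one>}"
begin

lemma H_carrier: "H \<subseteq> carrier G"
  using subgroup_H by (rule subgroup.subset)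

lemma finite_subset_carrier: "U \<subseteq> carrier G \<Longrightarrow> finite U"
  using finite_carrier by (rule rev_finite_subset)

text \<open>
  \<open>U H\<close> is a subgroup between \<open>H\<close> and \<open>G\<close>. If it is \<open>H\<close>, then \<open>U\<close> is contained in \<open>H\<close>; if it is \<open>G\<close>, then
  \<open>N = U (N \<inter> H) = U\<close>.
\<close>

lemma normalized_subgroup_cases:
  assumes N: "N \<lhd> G" and U: "subgroup U G" "U \<subseteq> N" "normalizes H U" "N \<inter> H \<subseteq> U"
  obtains "U = N \<inter> H" | "U = N"
proof -
  have sub: "subgroup (U <#> H) G"
    using U(1) subgroup_H U(3) by (rule subgroup_set_mult_normalizes)
  have "H \<subseteq> U <#> H"
    using U(1) H_carrier by (rule subset_set_mult_right)
  then consider "U <#> H = H" | "U <#> H = carrier G"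
    using maximal[OF sub] by blast
  then show ?thesis
  proof cases
    case 1
    then have "U \<subseteq> H"
      using subset_set_mult_left[OF subgroup_H] U(1) by (metis subgroup.subset)
    then show ?thesis using that(1) U by blast
  next
    case 2
    have NG: "subgroup N G" using N by (rule normal_imp_subgroup)
    have "x \<in> U" if x: "x \<in> N" for x
    proof -
      have "x \<in> U <#> H" using x NG 2 by (simp add: subgroup.mem_carrier)
      then obtain u h where uh: "u \<in> U" "h \<in> H" "x = u \<otimes> h"
        by (auto simp: set_mult_def)
      have c: "u \<in> carrier G" "h \<in> carrier G"
        using uh U(1) H_carrier by (auto simp: subgroup.mem_carrier)
      have "h = inv u \<otimes> x" using uh c by (simp add: word_simps)
      moreover have "inv u \<in> N" using uh U(2) NG by (auto simp: subgroup.m_inv_closed)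
      ultimately have "h \<in> N" using x NG by (simp only: subgroup.m_closed)
      then have "h \<in> U" using uh U(4) by blast
      then show ?thesis using uh U(1) by (simp add: subgroup.m_closed)
    qed
    then show ?thesis using that(2) U(2) by blast
  qed
qed

lemma normal_supplement:
  assumes N: "N \<lhd> G" "N \<noteq> {\<one>}"
  shows "N <#> H = carrier G"
proof -
  have NG: "subgroup N G" "normalizes (carrier G) N" using N(1) by (auto simp: normal_iff_normalizes)
  have sub: "subgroup (N <#> H) G"
    using NG(1) subgroup_H normalizes_subset[OF NG(2) H_carrier]
    by (rule subgroup_set_mult_normalizes)
  have "H \<subseteq> N <#> H"
    using NG(1) H_carrier by (rule subset_set_mult_right)
  moreover have "\<not> N \<subseteq> H" using core_free N by blast
  then have "N <#> H \<noteq> H"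
    using subset_set_mult_left[OF subgroup_H] NG(1) by (metis subgroup.subset)
  ultimately show ?thesis using maximal[OF sub] by blast
qed

lemma normalized_by_supplement_normal:
  assumes N: "N \<lhd> G" "N \<noteq> {\<one>}" and U: "subgroup U G" "normalizes N U" "normalizes H U"
  shows "U \<lhd> G"
proof -
  have "normalizes (N <#> H) U"
    using U N H_carrier
    by (intro normalizes_set_mult) (auto simp: subgroup.subset normal_imp_subgroup)
  then show ?thesis using normal_supplement[OF N] U(1) by (simp add: normal_iff_normalizes)
qed

lemma centralizer_normal: "N \<lhd> G \<Longrightarrow> centralizer N \<lhd> G"
  using normalizes_centralizer[OF subgroup_self] subgroup_centralizer
  by (simp add: normal_iff_normalizes subgroup.subset)

text \<open>
  This expresses that \<open>H\<close> acts faithfully on \<open>N\<close>: the kernel is normalised by \<open>H\<close> and centralised by \<open>N\<close>,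
  hence normal in \<open>N H = G\<close>.
\<close>

lemma centralizer_Int_H:
  assumes N: "N \<lhd> G" "N \<noteq> {\<one>}"
  shows "centralizer N \<inter> H = {\<one>}"
proof -
  have sub: "subgroup N G" "N \<subseteq> carrier G" 
    using N by (auto simp: normal_imp_subgroup subgroup.subset)
  have "subgroup (centralizer N \<inter> H) G"
    using subgroup_centralizer[OF sub(2)] subgroup_H by (rule subgroups_Inter_pair)
  moreover have "normalizes N (centralizer N \<inter> H)"
    using sub unfolding normalizes_def centralizer_def
    by (auto simp: conj_by_eq_iff_commute[THEN iffD2] subset_iff)
  moreover have "normalizes H (centralizer N)"
    using centralizer_normal[OF N(1)] H_carrier normalizes_subset
    by (auto simp: normal_iff_normalizes)
  then have "normalizes H (centralizer N \<inter> H)"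
    using normalizes_subgroup[OF subgroup_H] by (rule normalizes_Int)
  ultimately have "centralizer N \<inter> H \<lhd> G"
    using N normalized_by_supplement_normal by blast
  then show ?thesis using core_free by blast
qed

text \<open>
  A nontrivial centraliser of \<open>N\<close> is a normal subgroup, so together with \<open>H\<close> it generates \<open>G\<close>. Both
  normalise \<open>N \<inter> H\<close>.
\<close>

lemma trivial_Int_or_centralizer:
  assumes N: "N \<lhd> G" "N \<noteq> {\<one>}"
  shows "N \<inter> H = {\<one>} \<or> centralizer N = {\<one>}"
proof (rule disjCI)
  assume ne: "centralizer N \<noteq> {\<one>}"
  have NG: "subgroup N G" "normalizes (carrier G) N" "N \<subseteq> carrier G"
    using N(1) by (auto simp: normal_iff_normalizes subgroup.subset)
  have "subgroup (N \<inter> H) G"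
    using NG(1) subgroup_H by (rule subgroups_Inter_pair)
  moreover have "normalizes (centralizer N) (N \<inter> H)"
    using NG(3) by (rule centralizer_normalizes) blast
  moreover have "normalizes H (N \<inter> H)"
    using normalizes_subset[OF NG(2) H_carrier] normalizes_subgroup[OF subgroup_H]
    by (rule normalizes_Int)
  ultimately have "N \<inter> H \<lhd> G"
    using normalized_by_supplement_normal[OF centralizer_normal[OF N(1)] ne] by blast
  then show "N \<inter> H = {\<one>}" using core_free by blast
qed

text \<open>
  The elements of \<open>N\<close> that \<open>a\<close> fixes form an \<open>H\<close>-invariant subgroup, because \<open>H\<close> preserves \<open>{a, a\<^sup>-\<^sup>1}\<close>.
  It is not \<open>N\<close>, since \<open>H\<close> acts faithfully, so it is trivial. For a prime \<open>q\<close> dividing the order of \<open>N\<close>,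
  let \<open>Q\<close> be the unique \<open>a\<close>-invariant Sylow \<open>q\<close>-subgroup of \<open>N\<close>. Its conjugates under \<open>H\<close> are
  \<open>a\<close>-invariant too, so \<open>Q\<close> is \<open>H\<close>-invariant and equal to \<open>N\<close>. The centre of \<open>N\<close> is then nontrivial,
  and it is normal in \<open>G\<close>.
\<close>

lemma minimal_normal_complement_commutative:
  assumes N: "minimal_normalized (carrier G) N" and NH: "N \<inter> H = {\<one>}"
    and a: "a \<in> H" "a \<noteq> \<one>"
    and a_inv: "\<And>h. h \<in> H \<Longrightarrow> conj_by h a = a \<or> conj_by h a = inv a"
    and xy: "x \<in> N" "y \<in> N"
  shows "x \<otimes> y = y \<otimes> x"
proof -
  have aG: "a \<in> carrier G" using a H_carrier by auto
  have normal: "N \<lhd> G" using N by (rule normal_minimal_normalized)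
  have NG: "subgroup N G" "normalizes (carrier G) N" "N \<subseteq> carrier G" "N \<noteq> {\<one>}"
    using N by (auto simp: minimal_normalized_def subgroup.subset)
  have finN: "finite N" using NG(3) by (rule finite_subset_carrier)
  have aN: "normalizes {a} N" using NG(2) aG by (auto simp: normalizes_def)
  have aa: "{a, inv a} \<subseteq> carrier G" using aG by simp
  have Haa: "normalizes H {a, inv a}"
    unfolding normalizes_def
  proof (intro ballI)
    fix h x assume "h \<in> H" "x \<in> {a, inv a}"
    then show "conj_by h x \<in> {a, inv a}"
      using a_inv[of h] aG H_carrier by (cases "conj_by h a = a") (auto simp: subset_iff)
  qed
  define F where "F = N \<inter> centralizer {a, inv a}"
  have F: "subgroup F G" "normalizes H F"
    unfolding F_def using NG(1) subgroup_centralizer[OF aa] 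
      normalizes_centralizer[OF subgroup_H aa Haa] normalizes_subset[OF NG(2) H_carrier]
    by (auto intro: subgroups_Inter_pair normalizes_Int)
  have "F = {\<one>}"
  proof (rule normalized_subgroup_cases[OF normal F(1) _ F(2)])
    show "N \<inter> H \<subseteq> F" using NH F(1) by (simp add: subgroup.one_closed)
    assume "F = N"
    then have "z \<otimes> a = a \<otimes> z" if "z \<in> N" for z
      using that by (auto simp: F_def centralizer_def)
    then have "a \<in> centralizer N"
      using aG by (simp add: centralizer_def)
    then show ?thesis
      using centralizer_Int_H[OF normal NG(4)] a by blast
  qed (use NH in \<open>auto simp: F_def\<close>)
  have free: "z = \<one>" if z: "z \<in> N" "conj_by a z = z" for z
  proof -
    have zG: "z \<in> carrier G" using z NG by auto
    have "a \<in> centralizer {z}"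
      using z zG aG by (simp add: centralizer_def conj_by_eq_iff_commute)
    then have "inv a \<in> centralizer {z}"
      using subgroup_centralizer[of "{z}"] zG by (simp add: subgroup.m_inv_closed)
    then have "z \<in> F"
      using \<open>a \<in> centralizer {z}\<close> z zG by (simp add: F_def centralizer_def)
    then show ?thesis using \<open>F = {\<one>}\<close> by simp
  qed
  have "card N \<noteq> 1"
    using NG subgroup.one_closed[OF NG(1)] by (metis card_1_singletonE singletonD)
  then obtain q where q: "Factorial_Ring.prime q" "q dvd card N"
    using prime_factor_nat by blast
  have "\<exists>!Q. Q \<in> sylow_subgroups q N \<and> normalizes {a} Q"
    by (rule ex1_fixed_point_free_sylow[OF NG(1) finN aG aN _ q(1)]) (rule free)
  then obtain Q where Q: "Q \<in> sylow_subgroups q N" "normalizes {a} Q"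
    and unique: "\<And>Q'. Q' \<in> sylow_subgroups q N \<Longrightarrow> normalizes {a} Q' \<Longrightarrow> Q' = Q"
    by blast
  have QN: "subgroup Q G" "Q \<subseteq> N" "card Q = q ^ multiplicity q (card N)" "Q \<subseteq> carrier G"
    using Q NG by (auto simp: sylow_subgroups_def)
  have finQ: "finite Q" using QN(4) by (rule finite_subset_carrier)
  have inv_a_Q: "normalizes {inv a} Q"
    using finQ QN(4) aG Q(2) by (rule normalizes_inv)
  have "conj_by h ` Q = Q" if h: "h \<in> H" for h
  proof (rule unique)
    have hG: "h \<in> carrier G" "inv h \<in> H"
      using h H_carrier subgroup_H by (auto simp: subgroup.m_inv_closed)
    show "conj_by h ` Q \<in> sylow_subgroups q N"
      using Q(1) hG NG(2) QN
      by (auto simp: sylow_subgroups_def subgroup_conj_image card_conj_image normalizes_def)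
    have "conj_by a (conj_by h x) \<in> conj_by h ` Q" if x: "x \<in> Q" for x
    proof -
      have xG: "x \<in> carrier G" using x QN by auto
      have "conj_by a (conj_by h x) = conj_by h (conj_by (conj_by (inv h) a) x)"
        using xG hG aG by (simp add: conj_by_def word_simps)
      moreover have "conj_by (conj_by (inv h) a) x \<in> Q"
        using a_inv[OF hG(2)] x Q(2) inv_a_Q by (auto simp: normalizes_def)
      ultimately show ?thesis by blast
    qed
    then show "normalizes {a} (conj_by h ` Q)" by (auto simp: normalizes_def)
  qed
  then have "normalizes H Q" by (auto simp: normalizes_def)
  then have "Q = N"
  proof (rule normalized_subgroup_cases[OF normal QN(1,2)])
    show "N \<inter> H \<subseteq> Q" using NH QN(1) by (simp add: subgroup.one_closed)
    have "card N \<noteq> 0"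
      using finN subgroup.one_closed[OF NG(1)] by auto
    then have "multiplicity q (card N) > 0"
      using q by (simp add: prime_multiplicity_gt_zero_iff)
    then have "card Q \<noteq> 1" using QN(3) q(1) by (auto simp: prime_nat_iff)
    moreover assume "Q = N \<inter> H"
    ultimately show ?thesis using NH by simp
  qed
  interpret N: group "G\<lparr>carrier := N\<rparr>" using NG(1) by (rule subgroup_imp_group)
  have "\<exists>z\<in>N. z \<noteq> \<one> \<and> (\<forall>g\<in>N. g \<otimes> z = z \<otimes> g)"
    using N.p_group_center_nontrivial[OF q(1)] QN(3) \<open>Q = N\<close> NG(4) by (simp add: order_def)
  then obtain z where z: "z \<in> N" "z \<noteq> \<one>" "\<And>g. g \<in> N \<Longrightarrow> g \<otimes> z = z \<otimes> g" by blast
  have "N \<inter> centralizer N = N"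
  proof (rule minimal_normalized_cases[OF N])
    show "subgroup (N \<inter> centralizer N) G"
      using NG(1) subgroup_centralizer[OF NG(3)] by (rule subgroups_Inter_pair)
    show "normalizes (carrier G) (N \<inter> centralizer N)"
      using NG(2) normalizes_centralizer[OF subgroup_self NG(3) NG(2)] by (rule normalizes_Int)
    assume "N \<inter> centralizer N = {\<one>}"
    moreover have "z \<in> N \<inter> centralizer N"
      using z NG(3) by (auto simp: centralizer_def)
    ultimately show ?thesis using z by blast
  qed blast
  then show ?thesis using xy by (auto simp: centralizer_def set_eq_iff)
qed

end

section \<open>Minimal normal subgroups as products of simple groups\<close>

context group
begin

lemma normalizes_conj_image:
  assumes N: "N \<lhd> G" and T: "T \<subseteq> carrier G" "normalizes N T" and g: "g \<in> carrier G"
  shows "normalizes N (conj_by g ` T)"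
  unfolding normalizes_def
proof (intro ballI)
  have NG: "subgroup N G" "normalizes (carrier G) N" using N by (auto simp: normal_iff_normalizes)
  fix n x assume n: "n \<in> N" and "x \<in> conj_by g ` T"
  then obtain t where t: "t \<in> T" "x = conj_by g t" by blast
  have c: "n \<in> carrier G" "t \<in> carrier G" using n t NG T by (auto simp: subgroup.mem_carrier)
  have "conj_by n x = conj_by g (conj_by (conj_by (inv g) n) t)"
    using c g by (simp add: t(2) conj_by_def word_simps)
  moreover have "conj_by (conj_by (inv g) n) t \<in> T"
    using n g t NG T by (simp add: normalizes_def)
  ultimately show "conj_by n x \<in> conj_by g ` T" by blast
qed

text \<open>
  A conjugate of \<open>T\<close> is again a normal subgroup of \<open>N\<close>, and by minimality it either contains \<open>T\<close> or
  meets it trivially.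
\<close>

lemma minimal_normalized_conj_cases:
  assumes fin: "finite T" and N: "N \<lhd> G" and T: "minimal_normalized N T" "T \<subseteq> N"
    and g: "g \<in> carrier G"
  obtains "conj_by g ` T = T" | "conj_by g ` T \<subseteq> centralizer T"
proof -
  have NG: "subgroup N G" "normalizes (carrier G) N" using N by (auto simp: normal_iff_normalizes)
  have TG: "subgroup T G" "T \<subseteq> carrier G" "normalizes N T"
    using T by (auto simp: minimal_normalized_def subgroup.subset)
  let ?S = "conj_by g ` T"
  have S: "subgroup ?S G" "?S \<subseteq> N" "normalizes N ?S"
    using subgroup_conj_image[OF g TG(1)] normalizes_conj_image[OF N TG(2,3) g] NG T(2) g
    by (auto simp: normalizes_def)
  have "subgroup (?S \<inter> T) G" using S(1) TG(1) by (rule subgroups_Inter_pair)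
  moreover have "normalizes N (?S \<inter> T)" using S(3) TG(3) by (rule normalizes_Int)
  ultimately consider "?S \<inter> T = {\<one>}" | "?S \<inter> T = T"
    using minimal_normalized_cases[OF T(1)] by blast
  then show ?thesis
  proof cases
    case 1
    have "normalizes ?S T" "normalizes T ?S"
      using normalizes_subset TG(3) S T(2) by blast+
    then have "?S \<subseteq> centralizer T"
      using commute_if_disjoint_normalizing[OF S(1) TG(1) _ _ 1] S(1)
      by (auto simp: centralizer_def subgroup.mem_carrier)
    then show ?thesis by (rule that(2))
  next
    case 2
    then have "T \<subseteq> ?S" by blast
    then have "?S = T"
      using fin card_conj_image[OF g TG(2)] by (metis card_subset_eq finite_imageI)
    then show ?thesis by (rule that(1))
  qed
qed

text \<open>
  All conjugates of \<open>T\<close> are contained in \<open>T C\<^sub>N(T)\<close>, so the normal core of this subgroup contains \<open>T\<close>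
  and is nontrivial.
\<close>

lemma minimal_normal_factorization:
  assumes fin: "finite N" and N: "minimal_normalized (carrier G) N"
    and T: "minimal_normalized N T" "T \<subseteq> N"
  shows "N = T <#> (N \<inter> centralizer T)"
proof -
  have normal: "N \<lhd> G" using N by (rule normal_minimal_normalized)
  have NG: "subgroup N G" "normalizes (carrier G) N"
    using N by (auto simp: minimal_normalized_def)
  have TG: "subgroup T G" "T \<subseteq> carrier G" "normalizes N T" "T \<noteq> {\<one>}"
    using T by (auto simp: minimal_normalized_def subgroup.subset)
  have finT: "finite T" using T(2) fin by (rule finite_subset)
  let ?M = "N \<inter> centralizer T"
  have M: "subgroup ?M G" using NG(1) subgroup_centralizer[OF TG(2)] by (rule subgroups_Inter_pair)
  have MG: "?M \<subseteq> carrier G" using M by (rule subgroup.subset)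
  have L: "subgroup (T <#> ?M) G"
    using TG(1) M normalizes_subset[OF TG(3)] by (intro subgroup_set_mult_normalizes) auto
  have "T <#> ?M \<subseteq> N"
    using T(2) NG(1) by (auto simp: set_mult_def subgroup.m_closed)
  moreover have "core_in (carrier G) (T <#> ?M) = N"
  proof (rule minimal_normalized_cases[OF N])
    show "subgroup (core_in (carrier G) (T <#> ?M)) G"
      by (rule subgroup_core_in[OF _ L]) simp
    show "core_in (carrier G) (T <#> ?M) \<subseteq> N"
      using core_in_subset[OF subgroup_self] \<open>T <#> ?M \<subseteq> N\<close> by blast
    show "normalizes (carrier G) (core_in (carrier G) (T <#> ?M))"
      by (rule normalizes_core_in[OF subgroup_self])
    have "conj_by g t \<in> T <#> ?M" if "t \<in> T" "g \<in> carrier G" for g t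
    proof (rule minimal_normalized_conj_cases[OF finT normal T \<open>g \<in> carrier G\<close>])
      assume "conj_by g ` T = T"
      then show ?thesis using that subset_set_mult_left[OF M TG(2)] by blast
    next
      assume "conj_by g ` T \<subseteq> centralizer T"
      moreover have "conj_by g t \<in> N" using that T(2) NG(2) by (auto simp: normalizes_def)
      ultimately show ?thesis using that subset_set_mult_right[OF TG(1) MG] by blast
    qed
    then have "T \<subseteq> core_in (carrier G) (T <#> ?M)"
      using TG(2) by (auto simp: core_in_def)
    moreover assume "core_in (carrier G) (T <#> ?M) = {\<one>}"
    ultimately show "core_in (carrier G) (T <#> ?M) = N"
      using TG(1,4) subgroup.one_closed by blast
  qed
  ultimately show ?thesis
    using core_in_subset[OF subgroup_self] by blast
qed

lemma normalized_by_product: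
  assumes "A \<subseteq> carrier G" "B \<subseteq> carrier G" "U \<subseteq> carrier G"
    and "normalizes A U" "U \<subseteq> centralizer B"
  shows "normalizes (A <#> B) U"
proof (rule normalizes_set_mult)
  show "normalizes B U"
    unfolding normalizes_def
  proof (intro ballI)
    fix b u assume "b \<in> B" "u \<in> U"
    then show "conj_by b u \<in> U"
      using assms conj_by_eq_iff_commute[of b u] by (auto simp: centralizer_def subset_iff)
  qed
qed (use assms in auto)

lemma centralizer_set_mult:
  assumes "A \<subseteq> carrier G" "B \<subseteq> carrier G" "x \<in> centralizer A" "x \<in> centralizer B"
  shows "x \<in> centralizer (A <#> B)"
proof -
  have "x \<otimes> (a \<otimes> b) = (a \<otimes> b) \<otimes> x" if "a \<in> A" "b \<in> B" for a b
  proof -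
    have c: "x \<in> carrier G" "a \<in> carrier G" "b \<in> carrier G" "x \<otimes> a = a \<otimes> x" "x \<otimes> b = b \<otimes> x"
      using assms that by (auto simp: centralizer_def)
    have "x \<otimes> (a \<otimes> b) = a \<otimes> x \<otimes> b" using c by (simp flip: m_assoc)
    then show ?thesis using c by (simp add: m_assoc)
  qed
  then show ?thesis using assms by (auto simp: centralizer_def set_mult_def)
qed

text \<open>
  If \<open>T\<close> were abelian, it would centralise both factors of \<open>N = T C\<^sub>N(T)\<close>.
\<close>

lemma minimal_normal_factor_Int_centralizer:
  assumes fin: "finite N" and N: "minimal_normalized (carrier G) N" "centralizer N = {\<one>}"
    and T: "minimal_normalized N T" "T \<subseteq> N"
  shows "T \<inter> centralizer T = {\<one>}"
proof (rule minimal_normalized_cases[OF T(1)])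
  have NG: "subgroup N G" using N by (auto simp: minimal_normalized_def)
  have TG: "subgroup T G" "T \<subseteq> carrier G" "normalizes N T" "T \<noteq> {\<one>}"
    using T by (auto simp: minimal_normalized_def subgroup.subset)
  show "subgroup (T \<inter> centralizer T) G"
    using TG(1) subgroup_centralizer[OF TG(2)] by (rule subgroups_Inter_pair)
  show "normalizes N (T \<inter> centralizer T)"
    using TG(3) normalizes_centralizer[OF NG TG(2,3)] by (rule normalizes_Int)
  assume eq: "T \<inter> centralizer T = T"
  have "x = \<one>" if x: "x \<in> T" for x
  proof -
    have "x \<in> centralizer (N \<inter> centralizer T)"
      using x TG(2) by (auto simp: centralizer_def)
    then have "x \<in> centralizer (T <#> (N \<inter> centralizer T))"
      using x eq TG(2) NG by (intro centralizer_set_mult) (auto simp: subgroup.mem_carrier)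
    then show ?thesis
      using minimal_normal_factorization[OF fin N(1) T] N(2) by simp
  qed
  then show "T \<inter> centralizer T = {\<one>}"
    using TG subgroup.one_closed by blast
qed blast

text \<open>
  A normal subgroup of \<open>T\<close> is centralised by \<open>C\<^sub>N(T)\<close> and hence normal in \<open>N = T C\<^sub>N(T)\<close>.
\<close>

lemma minimal_normal_factor_simple:
  assumes fin: "finite N" and N: "minimal_normalized (carrier G) N" "centralizer N = {\<one>}"
    and T: "minimal_normalized N T" "T \<subseteq> N"
  shows "simple_group (G\<lparr>carrier := T\<rparr>)" "\<not> comm_group (G\<lparr>carrier := T\<rparr>)"
proof -
  have TG: "subgroup T G" "T \<subseteq> carrier G" "T \<noteq> {\<one>}"
    using T by (auto simp: minimal_normalized_def subgroup.subset)
  have "subgroup N G" using N by (simp add: minimal_normalized_def)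
  then have M: "N \<inter> centralizer T \<subseteq> carrier G" by (auto simp: subgroup.mem_carrier)
  show "simple_group (G\<lparr>carrier := T\<rparr>)"
  proof (rule simple_group_subgroupI[OF TG(1) finite_subset[OF T(2) fin] TG(3)])
    fix S assume S: "subgroup S G" "S \<subseteq> T" "normalizes T S"
    have "S \<subseteq> centralizer (N \<inter> centralizer T)"
      using S(2) TG(2) by (auto simp: centralizer_def)
    then have "normalizes (T <#> (N \<inter> centralizer T)) S"
      using S TG(2) M by (intro normalized_by_product) auto
    then have "normalizes N S"
      using minimal_normal_factorization[OF fin N(1) T] by simp
    then show "S = {\<one>} \<or> S = T" using minimal_normalized_cases[OF T(1) S(1,2)] by blast
  qed
  show "\<not> comm_group (G\<lparr>carrier := T\<rparr>)"
  proof
    assume "comm_group (G\<lparr>carrier := T\<rparr>)"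
    then have "x \<otimes> y = y \<otimes> x" if "x \<in> T" "y \<in> T" for x y
      using comm_groupE(4)[of "G\<lparr>carrier := T\<rparr>" x y] that by simp
    then have "T \<subseteq> centralizer T" using TG(2) by (auto simp: centralizer_def)
    then show False using minimal_normal_factor_Int_centralizer[OF fin N T] TG(3) by blast
  qed
qed

section \<open>Dihedral core-free maximal subgroups\<close>

text \<open>
  These are the properties of the rotations in a dihedral group that the argument uses. They allow \<open>C\<close> to
  be trivial, as it is when \<open>H\<close> has order two, and treat all dihedral groups alike.
\<close>

definition rotations :: "'a set \<Rightarrow> 'a set \<Rightarrow> bool" where
  "rotations C H \<longleftrightarrow> C \<subseteq> H \<and> \<one> \<in> C \<and> (\<forall>c\<in>C. \<forall>d\<in>C. c \<otimes> d \<in> C \<and> c \<otimes> d = d \<otimes> c) \<and>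
     (\<forall>h\<in>H. \<forall>c\<in>C. conj_by h c = c \<or> conj_by h c = inv c) \<and>
     (\<forall>h\<in>H - C. \<forall>k\<in>H - C. h \<otimes> k \<in> C)"

lemma rotations_square: "rotations C H \<Longrightarrow> h \<in> H \<Longrightarrow> h \<otimes> h \<in> C"
  by (cases "h \<in> C") (auto simp: rotations_def)

text \<open>
  Any nontrivial rotation will do. If there is none, the product of any two nontrivial elements is \<open>\<one>\<close>, so
  \<open>H\<close> has order two and its generator is central.
\<close>

lemma rotations_normal_cyclic:
  assumes C: "rotations C H" and H: "subgroup H G" "H \<noteq> {\<one>}"
  shows "\<exists>a\<in>H. a \<noteq> \<one> \<and> (\<forall>h\<in>H. conj_by h a = a \<or> conj_by h a = inv a)"
proof (cases "C = {\<one>}")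
  case False
  then obtain c where "c \<in> C" "c \<noteq> \<one>" using C by (auto simp: rotations_def)
  then show ?thesis using C unfolding rotations_def by (intro bexI[of _ c]) auto
next
  case True
  obtain a where a: "a \<in> H" "a \<noteq> \<one>" using H subgroup.one_closed by blast
  have HG: "H \<subseteq> carrier G" using H(1) by (rule subgroup.subset)
  have "conj_by h a = a" if h: "h \<in> H" for h
  proof (cases "h = \<one>")
    case True
    then show ?thesis using a HG by auto
  next
    case False
    have "h \<otimes> a = \<one>" "a \<otimes> h = \<one>"
      using C \<open>C = {\<one>}\<close> h a False by (auto simp: rotations_def)
    then show ?thesis using h a HG by (subst conj_by_eq_iff_commute) auto
  qed
  then show ?thesis using a by blast
qed

text \<open>
  In \<open>T \<times> M\<close> an identity between \<open>x u\<close> and \<open>y v\<close> holds in each factor. It serves to transfer the law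
  of dihedral groups to \<open>T\<close> when \<open>T\<close> is the projection of a subgroup of a dihedral group.
\<close>

lemma factor_squares_commute:
  assumes T: "subgroup T G" and M: "subgroup M G" and triv: "T \<inter> M = {\<one>}"
    and TM: "\<And>t m. t \<in> T \<Longrightarrow> m \<in> M \<Longrightarrow> t \<otimes> m = m \<otimes> t"
    and x: "x \<in> T" "u \<in> M" and y: "y \<in> T" "v \<in> M"
    and sq: "((x \<otimes> u) \<otimes> (x \<otimes> u)) \<otimes> ((y \<otimes> v) \<otimes> (y \<otimes> v)) =
      ((y \<otimes> v) \<otimes> (y \<otimes> v)) \<otimes> ((x \<otimes> u) \<otimes> (x \<otimes> u))"
  shows "(x \<otimes> x) \<otimes> (y \<otimes> y) = (y \<otimes> y) \<otimes> (x \<otimes> x)"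
proof -
  have mult: "(s \<otimes> m) \<otimes> (t \<otimes> n) = (s \<otimes> t) \<otimes> (m \<otimes> n)"
    if "s \<in> T" "t \<in> T" "m \<in> M" "n \<in> M" for s t m n
  proof -
    have c: "s \<in> carrier G" "t \<in> carrier G" "m \<in> carrier G" "n \<in> carrier G"
      using that T M by (auto simp: subgroup.mem_carrier)
    have "(s \<otimes> m) \<otimes> (t \<otimes> n) = s \<otimes> (m \<otimes> t) \<otimes> n" using c by (simp add: m_assoc)
    also have "m \<otimes> t = t \<otimes> m" using TM that by simp
    finally show ?thesis using c by (simp add: m_assoc)
  qed
  let ?p = "(x \<otimes> x) \<otimes> (y \<otimes> y)" and ?q = "(y \<otimes> y) \<otimes> (x \<otimes> x)"
  let ?m = "(u \<otimes> u) \<otimes> (v \<otimes> v)" and ?n = "(v \<otimes> v) \<otimes> (u \<otimes> u)"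
  have cl: "?p \<in> T" "?q \<in> T" "?m \<in> M" "?n \<in> M"
    using x y T M by (auto simp: subgroup.m_closed)
  have c: "?p \<in> carrier G" "?q \<in> carrier G" "?m \<in> carrier G" "?n \<in> carrier G"
    using cl subgroup.mem_carrier[OF T] subgroup.mem_carrier[OF M] by blast+
  have sub: "x \<otimes> x \<in> T" "y \<otimes> y \<in> T" "u \<otimes> u \<in> M" "v \<otimes> v \<in> M"
    using x y T M by (auto simp: subgroup.m_closed)
  have "?p \<otimes> ?m = ?q \<otimes> ?n"
    using sq unfolding mult[OF x(1) x(1) x(2) x(2)] mult[OF y(1) y(1) y(2) y(2)]
      mult[OF sub(1,2,3,4)] mult[OF sub(2,1,4,3)] .
  then have eq: "inv ?q \<otimes> ?p = ?n \<otimes> inv ?m"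
    using c by (metis inv_solve_left inv_solve_right m_assoc m_closed inv_closed)
  have "inv ?q \<otimes> ?p \<in> T" "?n \<otimes> inv ?m \<in> M"
    using cl T M by (auto simp only: subgroup.m_closed subgroup.m_inv_closed)
  then have "inv ?q \<otimes> ?p = \<one>" using eq triv by auto
  then have "?q \<otimes> (inv ?q \<otimes> ?p) = ?q" using c(2) by simp
  then show ?thesis using c mult_inv_cancel_left by simp
qed

end

context core_free_maximal_subgroup
begin

text \<open>
  The case of several simple factors is excluded here. With \<open>D = N \<inter> H\<close> and \<open>M = C\<^sub>N(T)\<close>, the group
  \<open>L = M D\<close> is the preimage in \<open>N = T \<times> M\<close> of the projection of \<open>D\<close> to \<open>T\<close>, so the core of \<open>L\<close> under
  \<open>H\<close> is the product of all the projections of \<open>D\<close> to the simple factors. That it equals \<open>D\<close>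
  makes \<open>D\<close> a direct product of conjugate subgroups, and a dihedral group has little room for those.
\<close>

lemma minimal_normal_simple_if_dihedral:
  assumes N: "minimal_normalized (carrier G) N" "centralizer N = {\<one>}" and NH: "N \<inter> H \<noteq> {\<one>}"
    and T: "minimal_normalized N T" "T \<subseteq> N" and C: "rotations C H"
  shows "T = N"
proof (rule ccontr)
  assume "T \<noteq> N"
  define D where "D = N \<inter> H"
  define M where "M = N \<inter> centralizer T"
  have normal: "N \<lhd> G" using N(1) by (rule normal_minimal_normalized)
  have NG: "subgroup N G" "normalizes (carrier G) N" "N \<subseteq> carrier G" "N \<noteq> {\<one>}"
    using N by (auto simp: minimal_normalized_def subgroup.subset)
  have TG: "subgroup T G" "T \<subseteq> carrier G" "normalizes N T" "T \<noteq> {\<one>}"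
    using T by (auto simp: minimal_normalized_def subgroup.subset)
  have finN: "finite N" and finT: "finite T"
    using NG(3) TG(2) by (auto intro: finite_subset_carrier)
  have D: "subgroup D G" "D \<subseteq> carrier G" "normalizes H D"
    unfolding D_def
    using subgroups_Inter_pair[OF NG(1) subgroup_H] NG(3)
      normalizes_Int[OF normalizes_subset[OF NG(2) H_carrier] normalizes_subgroup[OF subgroup_H]]
    by auto
  have M: "subgroup M G" "M \<subseteq> carrier G" "normalizes N M"
    unfolding M_def
    using subgroups_Inter_pair[OF NG(1) subgroup_centralizer[OF TG(2)]] NG(3)
      normalizes_Int[OF normalizes_subgroup[OF NG(1)] normalizes_centralizer[OF NG(1) TG(2,3)]]
    by auto
  have TM: "t \<otimes> m = m \<otimes> t" if "t \<in> T" "m \<in> M" for t m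
    using that by (auto simp: M_def centralizer_def)
  have N_TM: "N = T <#> M"
    unfolding M_def using finN N(1) T by (rule minimal_normal_factorization)
  have T_cent: "T \<inter> centralizer T = {\<one>}"
    using finN N T by (rule minimal_normal_factor_Int_centralizer)
  then have T_M: "T \<inter> M = {\<one>}"
    using subgroup.one_closed[OF TG(1)] subgroup.one_closed[OF M(1)] by (auto simp: M_def)
  interpret T: simple_group "G\<lparr>carrier := T\<rparr>"
    using finN N T by (rule minimal_normal_factor_simple(1))
  have T_nonabelian: "\<not> comm_group (G\<lparr>carrier := T\<rparr>)"
    using finN N T by (rule minimal_normal_factor_simple(2))
  define L where "L = M <#> D"
  have "normalizes D M" using M(3) by (rule normalizes_subset) (auto simp: D_def)
  then have L: "subgroup L G"
    unfolding L_def using M(1) D(1) by (intro subgroup_set_mult_normalizes)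
  have LN: "L \<subseteq> N"
    using NG(1) by (auto simp: L_def M_def D_def set_mult_def subgroup.m_closed)
  have M_L: "M \<subseteq> L" and D_L: "D \<subseteq> L"
    unfolding L_def using subset_set_mult_left[OF D(1) M(2)] subset_set_mult_right[OF M(1) D(2)] by blast+
  have core_L: "core_in H L \<subseteq> H"
  proof (rule normalized_subgroup_cases[OF normal])
    show "subgroup (core_in H L) G" using H_carrier L by (rule subgroup_core_in)
    show "core_in H L \<subseteq> N" using core_in_subset[OF subgroup_H] LN by blast
    show "normalizes H (core_in H L)" using subgroup_H by (rule normalizes_core_in)
    show "N \<inter> H \<subseteq> core_in H L"
      using D D_L by (auto simp: core_in_def D_def normalizes_def subset_iff)
  next
    \<comment> \<open>Here \<open>D\<close> projects onto \<open>T\<close>, so \<open>T\<close> inherits the law that squares commute.\<close>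
    assume "core_in H L = N"
    then have NL: "N \<subseteq> L" using core_in_subset[OF subgroup_H] by blast
    have split: "\<exists>m\<in>M. x \<otimes> m \<in> H" if x: "x \<in> T" for x
    proof -
      have "x \<in> L" using x T(2) NL by blast
      then obtain m d where md: "m \<in> M" "d \<in> D" "x = m \<otimes> d"
        by (auto simp: L_def set_mult_def)
      have c: "m \<in> carrier G" "d \<in> carrier G" "inv m \<in> M"
        using md M D by (auto simp: subgroup.m_inv_closed)
      have "x \<otimes> inv m = d" using TM[OF x c(3)] md(3) c by (simp add: word_simps)
      then show ?thesis using c(3) md(2) by (auto simp: D_def)
    qed
    have "(x \<otimes> x) \<otimes> (y \<otimes> y) = (y \<otimes> y) \<otimes> (x \<otimes> x)" if xy: "x \<in> T" "y \<in> T" for x y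
    proof -
      obtain u where u: "u \<in> M" "x \<otimes> u \<in> H" using split[OF xy(1)] by blast
      obtain v where v: "v \<in> M" "y \<otimes> v \<in> H" using split[OF xy(2)] by blast
      have sq: "((x \<otimes> u) \<otimes> (x \<otimes> u)) \<otimes> ((y \<otimes> v) \<otimes> (y \<otimes> v)) =
          ((y \<otimes> v) \<otimes> (y \<otimes> v)) \<otimes> ((x \<otimes> u) \<otimes> (x \<otimes> u))"
        using rotations_square[OF C u(2)] rotations_square[OF C v(2)] C
        unfolding rotations_def by blast
      show ?thesis
        by (rule factor_squares_commute[OF TG(1) M(1) T_M _ xy(1) u(1) xy(2) v(1) sq]) (rule TM)
    qed
    then have "comm_group (G\<lparr>carrier := T\<rparr>)"
      by (intro T.comm_group_if_squares_commute) auto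
    then show ?thesis using T_nonabelian by blast
  qed auto
  have H_cases: "conj_by h ` T = T \<or> conj_by h ` T \<subseteq> centralizer T" if "h \<in> H" for h
    using minimal_normalized_conj_cases[OF finT normal T, of h] that H_carrier by blast
  \<comment> \<open>The group \<open>T \<inter> L\<close> is the projection of \<open>D\<close>. A conjugate of it lies in \<open>L\<close> if \<open>T\<close> is mapped to
    itself, and in \<open>M\<close> otherwise.\<close>
  have TL: "T \<inter> L \<subseteq> core_in H L"
  proof
    fix r assume r: "r \<in> T \<inter> L"
    then obtain m d where md: "m \<in> M" "d \<in> D" "r = m \<otimes> d"
      by (auto simp: L_def set_mult_def)
    have c: "r \<in> carrier G" "m \<in> carrier G" "d \<in> carrier G" using r md TG M D by auto
    have "conj_by h r \<in> L" if h: "h \<in> H" for h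
    proof -
      have hG: "h \<in> carrier G" using h H_carrier by auto
      have hN: "x \<in> N \<Longrightarrow> conj_by h x \<in> N" for x
        using NG(2) hG by (auto simp: normalizes_def)
      consider "conj_by h ` T = T" | "conj_by h ` T \<subseteq> centralizer T"
        using H_cases h by blast
      then show ?thesis
      proof cases
        case 1
        have "conj_by h m \<otimes> x = x \<otimes> conj_by h m" if x: "x \<in> T" for x
        proof -
          have "x \<in> conj_by h ` T" using 1 x by simp
          then obtain y where y: "y \<in> T" "x = conj_by h y" by blast
          then have "conj_by h (m \<otimes> y) = conj_by h (y \<otimes> m)" using TM[OF _ md(1)] by simp
          moreover have "y \<in> carrier G" using y TG(2) by blast
          ultimately show ?thesis using y(2) c hG by (simp add: conj_by_mult)
        qed
        then have "conj_by h m \<in> M"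
          using hN hG c md by (simp add: M_def centralizer_def)
        moreover have "conj_by h d \<in> D"
          using D(3) h md by (simp add: normalizes_def)
        ultimately show ?thesis
          using c hG md by (auto simp: L_def set_mult_def conj_by_mult)
      next
        case 2
        then have "conj_by h r \<in> M" using r hN T(2) by (auto simp: M_def)
        then show ?thesis using M_L by blast
      qed
    qed
    then show "r \<in> core_in H L" using c by (simp add: core_in_def)
  qed
  define R where "R = T \<inter> H"
  have R: "subgroup R G" "R \<subseteq> carrier G" "R \<subseteq> D"
    unfolding R_def D_def using subgroups_Inter_pair[OF TG(1) subgroup_H] TG T(2) by auto
  have D_RM: "D \<subseteq> R <#> M"
  proof
    fix d assume d: "d \<in> D"
    then have "d \<in> T <#> M" using N_TM by (auto simp: D_def)
    then obtain t m where tm: "t \<in> T" "m \<in> M" "d = t \<otimes> m" by (auto simp: set_mult_def)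
    have c: "t \<in> carrier G" "m \<in> carrier G" "inv m \<in> M"
      using tm M TG by (auto simp: subgroup.m_inv_closed)
    have "t = inv m \<otimes> d" using tm c by (simp add: TM word_simps)
    then have "t \<in> T \<inter> L" using d c(3) tm(1) by (auto simp: L_def set_mult_def)
    then have "t \<in> R" using TL core_L tm by (auto simp: R_def)
    then show "d \<in> R <#> M" using tm by (auto simp: set_mult_def)
  qed
  \<comment> \<open>If \<open>T \<inter> H\<close> were trivial, \<open>D\<close> would centralise all conjugates of \<open>T\<close> and hence \<open>N\<close>.\<close>
  have "R \<noteq> {\<one>}"
  proof
    assume "R = {\<one>}"
    then have DM: "D \<subseteq> M" using D_RM M(2) by (auto simp: set_mult_def subset_iff)
    have "core_in (carrier G) M = {\<one>}"
    proof (rule minimal_normalized_cases[OF N(1)])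
      show "subgroup (core_in (carrier G) M) G"
        using M(1) by (intro subgroup_core_in) auto
      show "core_in (carrier G) M \<subseteq> N"
        using core_in_subset[OF subgroup_self] by (auto simp: M_def)
      show "normalizes (carrier G) (core_in (carrier G) M)"
        by (rule normalizes_core_in[OF subgroup_self])
      assume "core_in (carrier G) M = N"
      then have "T \<subseteq> M" using core_in_subset[OF subgroup_self] T(2) by blast
      then show ?thesis using T_M TG(4) by blast
    qed
    moreover have "D \<subseteq> core_in (carrier G) M"
    proof
      fix d assume d: "d \<in> D"
      have "conj_by g d \<in> M" if "g \<in> carrier G" for g
      proof -
        have "g \<in> N <#> H" using that normal_supplement[OF normal NG(4)] by simp
        then obtain n h where nh: "n \<in> N" "h \<in> H" "g = n \<otimes> h" by (auto simp: set_mult_def)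
        have "conj_by h d \<in> M" using nh d D(3) DM by (auto simp: normalizes_def)
        then have "conj_by n (conj_by h d) \<in> M" using nh M(3) by (simp add: normalizes_def)
        then show ?thesis using nh d NG(3) H_carrier D(2) by (auto simp: conj_by_conj_by subset_iff)
      qed
      then show "d \<in> core_in (carrier G) M" using d D(2) by (auto simp: core_in_def)
    qed
    ultimately show False using NH D(1) subgroup.one_closed by (fastforce simp: D_def)
  qed
  obtain h0 where h0: "h0 \<in> H" "conj_by h0 ` T \<noteq> T"
  proof (rule ccontr)
    assume "\<not> thesis"
    then have "normalizes H T" using that by (auto simp: normalizes_def)
    then have "T \<lhd> G" using normalized_by_supplement_normal[OF normal NG(4) TG(1,3)] by simp
    then have "normalizes (carrier G) T" by (simp add: normal_iff_normalizes)
    then show False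
      using minimal_normalized_cases[OF N(1) TG(1) T(2)] TG(4) \<open>T \<noteq> N\<close> by blast
  qed
  then have h0_cent: "conj_by h0 ` T \<subseteq> centralizer T" using H_cases by blast
  \<comment> \<open>A rotation in \<open>T\<close> lies also in the conjugate of \<open>T\<close> by \<open>h0\<close>, which commutes with \<open>T\<close>.\<close>
  have RC: "c = \<one>" if c: "c \<in> R" "c \<in> C" for c
  proof -
    have cG: "c \<in> carrier G" using c R by auto
    have "conj_by h0 c = c \<or> conj_by h0 c = inv c"
      using C h0 c by (simp add: rotations_def)
    then have "conj_by h0 c \<in> T"
      using c TG(1) by (auto simp: R_def subgroup.m_inv_closed)
    moreover have "conj_by h0 c \<in> centralizer T" using h0_cent c by (auto simp: R_def)
    ultimately have "conj_by h0 c = \<one>" using T_cent by blast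
    then show ?thesis using cG h0 H_carrier by auto
  qed
  obtain t where t: "t \<in> R" "t \<noteq> \<one>"
    using \<open>R \<noteq> {\<one>}\<close> R(1) subgroup.one_closed by blast
  have tG: "t \<in> carrier G" using t R by auto
  have rt: "r \<otimes> t = \<one>" if r: "r \<in> R" "r \<noteq> \<one>" for r
  proof (rule RC)
    show "r \<otimes> t \<in> R" using r t R(1) by (simp add: subgroup.m_closed)
    have "r \<in> H - C" "t \<in> H - C" using r t RC by (auto simp: R_def)
    then show "r \<otimes> t \<in> C" using C by (simp add: rotations_def)
  qed
  have R_eq: "r = \<one> \<or> r = t" if "r \<in> R" for r
    using rt[OF that] rt[OF t] that R(2) tG by (metis r_cancel subsetD)
  obtain x where x: "x \<in> T" "t \<otimes> x = x \<otimes> t" "x \<noteq> \<one>" "x \<noteq> t"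
    using T.no_self_centralizing_involution[of t] finT T_nonabelian t rt[OF t] by (auto simp: R_def)
  have xG: "x \<in> carrier G" using x TG by auto
  \<comment> \<open>The subgroup \<open>C\<^sub>G(D) H\<close> normalises \<open>D\<close>, which is not normal in \<open>G\<close>; so it is \<open>H\<close>.\<close>
  have "centralizer D \<subseteq> H"
  proof -
    have cD: "subgroup (centralizer D) G" using D(2) by (rule subgroup_centralizer)
    have cDG: "centralizer D \<subseteq> carrier G" by (auto simp: centralizer_def)
    have "normalizes H (centralizer D)"
      using subgroup_H D(2,3) by (rule normalizes_centralizer)
    then have "subgroup (centralizer D <#> H) G"
      using cD subgroup_H by (intro subgroup_set_mult_normalizes)
    moreover have "H \<subseteq> centralizer D <#> H"
      using cD H_carrier by (rule subset_set_mult_right)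
    moreover have "centralizer D <#> H \<noteq> carrier G"
    proof
      assume "centralizer D <#> H = carrier G"
      moreover have "normalizes (centralizer D <#> H) D"
        using centralizer_normalizes[OF D(2)] D cDG H_carrier
        by (intro normalizes_set_mult) auto
      ultimately have "D \<lhd> G" using D(1) by (simp add: normal_iff_normalizes)
      then show False using core_free NH by (auto simp: D_def)
    qed
    ultimately have "centralizer D <#> H = H" using maximal by blast
    then show ?thesis using subset_set_mult_left[OF subgroup_H cDG] by simp
  qed
  moreover have "x \<in> centralizer (R <#> M)"
    using x(1,2) xG R(2) M(2) R_eq tG
    by (intro centralizer_set_mult) (auto simp: centralizer_def TM dest!: R_eq)
  then have "x \<in> centralizer D" using D_RM by (auto simp: centralizer_def)
  ultimately have "x \<in> R" using x(1) by (auto simp: R_def)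
  then show False using R_eq x by blast
qed

end

text \<open>
  The preimage of the rotations \<open>(i, False)\<close>. A reflection \<open>h\<close> inverts a rotation \<open>c\<close> because
  \<open>c h c = h\<close>.
\<close>

lemma (in group) rotations_of_dihedral:
  assumes H: "subgroup H G" and dih: "is_dihedral (G\<lparr>carrier := H\<rparr>)"
  shows "\<exists>C. rotations C H" "H \<noteq> {\<one>}"
proof -
  obtain n f where n: "n \<ge> 1" and f: "f \<in> iso (G\<lparr>carrier := H\<rparr>) (dihedral_group n)"
    using dih by (auto simp: is_dihedral_def is_iso_def)
  have HG: "H \<subseteq> carrier G" using H by (rule subgroup.subset)
  have inj: "h = k" if "f h = f k" "h \<in> H" "k \<in> H" for h k
    using f that by (auto simp: iso_def bij_betw_def inj_on_def)
  have mult: "f (h \<otimes> k) = f h \<otimes>\<^bsub>dihedral_group n\<^esub> f k" if "h \<in> H" "k \<in> H" for h k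
    using f that by (auto simp: iso_def hom_def)
  have range: "fst (f h) mod int n = fst (f h)" if "h \<in> H" for h
  proof -
    have "f h \<in> carrier (dihedral_group n)" using f that by (auto simp: iso_def hom_def)
    then show ?thesis
      using n by (auto simp: dihedral_group_def carrier_integer_mod_group)
  qed
  have dmult: "x \<otimes>\<^bsub>dihedral_group n\<^esub> y =
      ((if snd x then fst x - fst y else fst x + fst y) mod int n, snd x \<noteq> snd y)" for x y
    by (auto simp: dihedral_group_def case_prod_beta)
  have cl: "h \<otimes> k \<in> H" if "h \<in> H" "k \<in> H" for h k using that H by (simp add: subgroup.m_closed)
  define C where "C = {h \<in> H. \<not> snd (f h)}"
  have comm: "c \<otimes> d = d \<otimes> c" if "c \<in> C" "d \<in> C" for c d
    using that by (intro inj) (auto simp: C_def mult dmult cl add.commute)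
  have one: "\<one> \<in> H" using H by (rule subgroup.one_closed)
  have "\<not> snd (f (\<one> \<otimes> \<one>))"
    unfolding mult[OF one one] dmult by simp
  then have oneC: "\<one> \<in> C" using one by (simp add: C_def)
  have "conj_by h c = c \<or> conj_by h c = inv c" if hc: "h \<in> H" "c \<in> C" for h c
  proof -
    have cH: "c \<in> H" and G: "h \<in> carrier G" "c \<in> carrier G" using hc HG by (auto simp: C_def)
    show ?thesis
    proof (cases "snd (f h)")
      case False
      then show ?thesis
        using comm[of h c] hc G by (simp add: C_def conj_by_eq_iff_commute)
    next
      case True
      have "f (c \<otimes> h \<otimes> c) = f h"
        using hc cH True range[OF hc(1)]
        by (auto simp: C_def mult cl dmult prod_eq_iff mod_simps)
      then have "c \<otimes> h \<otimes> c = h" using hc cH by (intro inj) (auto simp: cl)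
      then have "h \<otimes> c = inv c \<otimes> h"
        using G by (metis inv_mult_cancel_left m_assoc m_closed)
      then have "conj_by h c = inv c"
        using G by (simp add: conj_by_def word_simps)
      then show ?thesis by simp
    qed
  qed
  then have "rotations C H"
    using comm oneC cl by (auto simp: rotations_def C_def mult dmult)
  then show "\<exists>C. rotations C H" by blast
  have "card H = 2 * n"
    using iso_same_order[OF f] order_dihedral_group[OF n] by (simp add: order_def)
  then show "H \<noteq> {\<one>}" using n by auto
qed

lemma (in core_free_maximal_subgroup) dihedral_cases:
  assumes C: "rotations C H" and H: "H \<noteq> {\<one>}"
  obtains (commutative) N where "minimal_normalized (carrier G) N"
      "\<And>x y. x \<in> N \<Longrightarrow> y \<in> N \<Longrightarrow> x \<otimes> y = y \<otimes> x"
    | (simple) N where "N \<lhd> G" "centralizer N = {\<one>}"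
      "simple_group (G\<lparr>carrier := N\<rparr>)" "\<not> comm_group (G\<lparr>carrier := N\<rparr>)"
proof -
  have "carrier G \<noteq> {\<one>}"
    using H H_carrier subgroup.one_closed[OF subgroup_H] by auto
  moreover have "normalizes (carrier G) (carrier G)" by (auto simp: normalizes_def)
  ultimately obtain N where N: "minimal_normalized (carrier G) N"
    using exists_minimal_normalized[OF finite_carrier subgroup_self] by blast
  have normal: "N \<lhd> G" using N by (rule normal_minimal_normalized)
  have NG: "subgroup N G" "N \<noteq> {\<one>}" using N by (auto simp: minimal_normalized_def)
  have finN: "finite N" using subgroup.subset[OF NG(1)] by (rule finite_subset_carrier)
  show ?thesis
  proof (cases "N \<inter> H = {\<one>}")
    case True
    obtain a where a: "a \<in> H" "a \<noteq> \<one>" "\<And>h. h \<in> H \<Longrightarrow> conj_by h a = a \<or> conj_by h a = inv a"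
      using rotations_normal_cyclic[OF C subgroup_H H] by blast
    show ?thesis
      using minimal_normal_complement_commutative[OF N True a] by (rule commutative[OF N])
  next
    case False
    then have cent: "centralizer N = {\<one>}"
      using trivial_Int_or_centralizer[OF normal NG(2)] by blast
    obtain T where T: "T \<subseteq> N" "minimal_normalized N T"
      using exists_minimal_normalized[OF finN NG normalizes_subgroup[OF NG(1)]] by blast
    have "T = N"
      using N cent False T(2,1) C by (rule minimal_normal_simple_if_dihedral)
    then show ?thesis
      using minimal_normal_factor_simple[OF finN N cent T(2,1)] normal cent
      by (intro simple[of N]) auto
  qed
qed

text \<open>
  \<open>G\<close> acts on \<open>N\<close> by conjugation, with kernel \<open>C\<^sub>G(N) = 1\<close>, and the elements of \<open>N\<close> induce the inner
  automorphisms.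
\<close>

lemma almost_simpleI:
  fixes G :: "'a monoid" (structure)
  assumes "group G" and N: "N \<lhd> G" and fin: "finite N"
    and simple: "simple_group (G\<lparr>carrier := N\<rparr>)" "\<not> comm_group (G\<lparr>carrier := N\<rparr>)"
    and cent: "group.centralizer G N = {\<one>}"
  shows "almost_simple G"
proof -
  interpret group G by fact
  let ?T = "G\<lparr>carrier := N\<rparr>"
  interpret T: simple_group ?T by fact
  have NG: "subgroup N G" "normalizes (carrier G) N" "N \<subseteq> carrier G"
    using N by (auto simp: normal_iff_normalizes subgroup.subset)
  have cl: "conj_by g x \<in> N" if "g \<in> carrier G" "x \<in> N" for g x
    using NG(2) that by (simp add: normalizes_def)
  define c where "c = (\<lambda>g. \<lambda>x\<in>N. conj_by g x)"
  have cBij: "c g \<in> Bij N" if g: "g \<in> carrier G" for g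
  proof -
    have "bij_betw (conj_by g) N N"
      by (rule bij_betw_byWitness[where f' = "conj_by (inv g)"])
        (use g cl NG(3) in \<open>auto simp: subset_iff\<close>)
    then show ?thesis by (simp add: c_def Bij_def cong: bij_betw_cong)
  qed
  have cauto: "c g \<in> auto ?T" if g: "g \<in> carrier G" for g
    using cBij[OF g] g cl NG
    by (auto simp: auto_def hom_def c_def conj_by_mult subgroup.m_closed subset_iff)
  have c_mult: "c (g \<otimes> h) = c g \<otimes>\<^bsub>AutoGroup ?T\<^esub> c h" if "g \<in> carrier G" "h \<in> carrier G" for g h
  proof -
    have "c g \<otimes>\<^bsub>AutoGroup ?T\<^esub> c h = compose N (c g) (c h)"
      using that cBij by (simp add: AutoGroup_def BijGroup_def)
    moreover have "c (g \<otimes> h) = compose N (c g) (c h)"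
      using that cl NG(3)
      by (auto simp: c_def compose_def conj_by_conj_by subset_iff intro!: restrict_ext)
    ultimately show ?thesis by simp
  qed
  have hom: "group_hom G (AutoGroup ?T) c"
    using c_mult cauto T.AutoGroup is_group
    by (auto simp: group_hom_def group_hom_axioms_def hom_def AutoGroup_def)
  have "subgroup (c ` carrier G) (AutoGroup ?T)"
    using hom by (rule group_hom.img_is_subgroup)
  moreover have "inner_automorphisms ?T \<subseteq> c ` carrier G"
  proof
    fix \<phi> assume "\<phi> \<in> inner_automorphisms ?T"
    then obtain t where t: "t \<in> N" "\<phi> = (\<lambda>x\<in>N. t \<otimes> x \<otimes> inv\<^bsub>?T\<^esub> t)"
      by (auto simp: inner_automorphisms_def)
    then have "\<phi> = c t"
      using NG by (simp add: c_def conj_by_def m_inv_consistent)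
    then show "\<phi> \<in> c ` carrier G" using t NG by blast
  qed
  moreover have "inj_on c (carrier G)"
  proof (rule inj_onI)
    fix g h assume gh: "g \<in> carrier G" "h \<in> carrier G" and eq: "c g = c h"
    have "inv h \<otimes> g \<in> centralizer N"
    proof -
      have "(inv h \<otimes> g) \<otimes> x = x \<otimes> (inv h \<otimes> g)" if x: "x \<in> N" for x
      proof -
        have xG: "x \<in> carrier G" using x NG by auto
        have "conj_by g x = conj_by h x"
          using fun_cong[OF eq, of x] x by (simp add: c_def)
        then have "conj_by (inv h \<otimes> g) x = x" using gh xG by (simp add: conj_by_conj_by)
        then show ?thesis using gh xG by (simp add: conj_by_eq_iff_commute)
      qed
      then show ?thesis using gh by (simp add: centralizer_def)
    qed
    then have "inv h \<otimes> g = \<one>" using cent by simp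
    then have "h \<otimes> (inv h \<otimes> g) = h" using gh by simp
    then show "g = h" using gh by (simp add: word_simps)
  qed
  then have "c \<in> iso G (AutoGroup ?T\<lparr>carrier := c ` carrier G\<rparr>)"
    using c_mult by (auto simp: iso_def hom_def bij_betw_def)
  then have "G \<cong> AutoGroup ?T\<lparr>carrier := c ` carrier G\<rparr>" by (rule is_isoI)
  ultimately show ?thesis
    unfolding almost_simple_def using simple fin
    by (intro exI[of _ ?T] exI[of _ "c ` carrier G"]) auto
qed

section \<open>Primitive permutation groups\<close>

lemma perm_group_eqI:
  assumes act: "group_action (perm_group \<Omega> G) \<Omega> (\<lambda>g. g)" and "g \<in> G" "h \<in> G"
    and "\<And>x. x \<in> \<Omega> \<Longrightarrow> g x = h x"
  shows "g = h"
proof -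
  have "g \<in> extensional \<Omega>" "h \<in> extensional \<Omega>"
    using group_action.bij_prop0[OF act] assms by (auto simp: Bij_imp_extensional)
  then show ?thesis using assms(4) by (rule extensionalityI)
qed

text \<open>
  A subgroup \<open>K\<close> that contains the stabiliser of \<open>\<alpha>\<close> gives a \<open>G\<close>-invariant equivalence relation, in which
  \<open>g \<alpha>\<close> and \<open>h \<alpha>\<close> are related if \<open>g\<^sup>-\<^sup>1 h\<close> is in \<open>K\<close>. By primitivity it is equality, and then \<open>K\<close> is
  the stabiliser, or universal, and then \<open>K = G\<close>. The stabiliser is core-free since a normal subgroup
  that fixes \<open>\<alpha>\<close> fixes all images of \<open>\<alpha>\<close>, which are all the points.
\<close>

lemma primitive_core_free_maximal:
  assumes fin: "finite \<Omega>" and prim: "primitive_perm_group \<Omega> G" and \<alpha>: "\<alpha> \<in> \<Omega>"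
  shows "core_free_maximal_subgroup (perm_group \<Omega> G) (point_stabilizer \<Omega> G \<alpha>)"
proof -
  let ?P = "perm_group \<Omega> G" and ?H = "point_stabilizer \<Omega> G \<alpha>"
  have sub: "subgroup G (BijGroup \<Omega>)" and trans: "transitive_action ?P \<Omega> (\<lambda>g. g)"
    using prim by (auto simp: primitive_perm_group_def transitive_perm_group_def)
  interpret act: transitive_action ?P \<Omega> "\<lambda>g. g" by fact
  interpret P: group ?P using act.group_hom by (simp add: group_hom_def)
  have apply_mult: "(g \<otimes>\<^bsub>BijGroup \<Omega>\<^esub> h) x = g (h x)" if "g \<in> G" "h \<in> G" "x \<in> \<Omega>" for g h x
    using act.composition_rule[of x g h] that by simp
  have apply_inv: "(inv\<^bsub>?P\<^esub> g) (g x) = x" if "g \<in> G" "x \<in> \<Omega>" for g x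
    using act.orbit_sym_aux[of g x "g x"] that by simp
  have apply_one: "\<one>\<^bsub>?P\<^esub> x = x" if "x \<in> \<Omega>" for x
    using act.id_eq_one that by (metis restrict_apply')
  have closed: "g x \<in> \<Omega>" if "g \<in> G" "x \<in> \<Omega>" for g x
    using act.element_image[of g x "g x"] that by simp
  have orb: "\<exists>g\<in>G. g \<alpha> = x" if "x \<in> \<Omega>" for x
    using act.unique_orbit[OF \<alpha> that] by simp
  have mult_G: "g \<otimes>\<^bsub>BijGroup \<Omega>\<^esub> h \<in> G" if "g \<in> G" "h \<in> G" for g h
    using P.m_closed[of g h] that by simp
  have inv_G: "inv\<^bsub>?P\<^esub> g \<in> G" if "g \<in> G" for g
    using P.inv_closed[of g] that by simp
  note PG = mult_G inv_G
  have H: "h \<in> ?H \<longleftrightarrow> h \<in> G \<and> h \<alpha> = \<alpha>" for h by (simp add: stabilizer_def)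
  show ?thesis
  proof (intro core_free_maximal_subgroup.intro core_free_maximal_subgroup_axioms.intro P.is_group)
    have "G \<subseteq> \<Omega> \<rightarrow>\<^sub>E \<Omega>"
      using act.bij_prop0 by (auto simp: Bij_def PiE_def bij_betw_def)
    then show "finite (carrier ?P)"
      using fin by (auto intro: finite_subset finite_PiE)
    show "subgroup ?H ?P" using \<alpha> by (rule act.stabilizer_subgroup)
  next
    fix N assume N: "N \<lhd> ?P" "N \<subseteq> ?H"
    have "g = \<one>\<^bsub>?P\<^esub>" if g: "g \<in> N" for g
    proof (rule perm_group_eqI[OF act.group_action_axioms])
      show "g \<in> G" "\<one>\<^bsub>?P\<^esub> \<in> G" using g N(2) H P.one_closed by auto
      fix x assume x: "x \<in> \<Omega>"
      obtain k where k: "k \<in> G" "k \<alpha> = x" using orb x by blast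
      have "inv\<^bsub>?P\<^esub> k \<otimes>\<^bsub>?P\<^esub> g \<otimes>\<^bsub>?P\<^esub> k \<in> N"
        using normal.inv_op_closed1[OF N(1)] k g by simp
      then have "(inv\<^bsub>?P\<^esub> k \<otimes>\<^bsub>?P\<^esub> g \<otimes>\<^bsub>?P\<^esub> k) \<alpha> = \<alpha>" using N(2) H by blast
      then have "(inv\<^bsub>?P\<^esub> k) (g x) = \<alpha>"
        using k \<open>g \<in> G\<close> \<alpha> x by (simp add: apply_mult PG)
      then have "k ((inv\<^bsub>?P\<^esub> k) (g x)) = x" using k by simp
      moreover have "k ((inv\<^bsub>?P\<^esub> k) (g x)) = g x"
        using apply_inv[of "inv\<^bsub>?P\<^esub> k" "g x"] PG k \<open>g \<in> G\<close> closed x P.inv_inv[of k] by simp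
      ultimately show "g x = \<one>\<^bsub>?P\<^esub> x" using apply_one x by simp
    qed
    then show "N = {\<one>\<^bsub>?P\<^esub>}"
      using normal_imp_subgroup[OF N(1)] subgroup.one_closed by blast
  next
    fix K assume K: "subgroup K ?P" "?H \<subseteq> K"
    have KG: "K \<subseteq> G" using subgroup.subset[OF K(1)] by simp
    have mem_K: "inv\<^bsub>?P\<^esub> g \<otimes>\<^bsub>?P\<^esub> h \<in> K" if "g \<in> G" "h \<in> G" "g \<alpha> = h \<alpha>" for g h
    proof -
      have "(inv\<^bsub>?P\<^esub> g \<otimes>\<^bsub>?P\<^esub> h) \<alpha> = \<alpha>"
        using that \<alpha> apply_inv[of g \<alpha>] by (simp add: apply_mult PG)
      moreover have "inv\<^bsub>?P\<^esub> g \<otimes>\<^bsub>?P\<^esub> h \<in> G" using that by (simp add: PG)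
      ultimately have "inv\<^bsub>?P\<^esub> g \<otimes>\<^bsub>?P\<^esub> h \<in> ?H" unfolding H by (rule conjI[rotated])
      then show ?thesis using K(2) by (rule rev_subsetD)
    qed
    \<comment> \<open>Whether \<open>g\<^sup>-\<^sup>1 h\<close> is in \<open>K\<close> depends only on \<open>g \<alpha>\<close> and \<open>h \<alpha>\<close>, because \<open>K\<close> contains the stabiliser.\<close>
    define r where "r = {(g \<alpha>, h \<alpha>) |g h. g \<in> G \<and> h \<in> G \<and> inv\<^bsub>?P\<^esub> g \<otimes>\<^bsub>?P\<^esub> h \<in> K}"
    have rI: "(x, y) \<in> r"
      if "g \<in> G" "h \<in> G" "x = g \<alpha>" "y = h \<alpha>" "inv\<^bsub>?P\<^esub> g \<otimes>\<^bsub>?P\<^esub> h \<in> K" for x y g h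
      using that unfolding r_def by blast
    have "equiv \<Omega> r"
    proof (rule equivI)
      show "r \<subseteq> \<Omega> \<times> \<Omega>" using closed \<alpha> by (auto simp: r_def)
      show "refl_on \<Omega> r"
        unfolding refl_on_def
      proof
        fix x assume "x \<in> \<Omega>"
        then obtain g where "g \<in> G" "g \<alpha> = x" using orb by blast
        then show "(x, x) \<in> r" using mem_K[of g g] by (intro rI[of g g]) simp_all
      qed
      show "sym r"
      proof (rule symI)
        fix x y assume "(x, y) \<in> r"
        then obtain g h where gh: "g \<in> G" "h \<in> G" "x = g \<alpha>" "y = h \<alpha>"
          "inv\<^bsub>?P\<^esub> g \<otimes>\<^bsub>?P\<^esub> h \<in> K" by (auto simp: r_def)
        have "inv\<^bsub>?P\<^esub> (inv\<^bsub>?P\<^esub> g \<otimes>\<^bsub>?P\<^esub> h) \<in> K" using gh K(1) by (simp only: subgroup.m_inv_closed)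
        moreover have "inv\<^bsub>?P\<^esub> (inv\<^bsub>?P\<^esub> g \<otimes>\<^bsub>?P\<^esub> h) = inv\<^bsub>?P\<^esub> h \<otimes>\<^bsub>?P\<^esub> g"
          using P.inv_mult_group[of "inv\<^bsub>?P\<^esub> g" h] P.inv_inv[of g] P.inv_closed[of g] gh by simp
        ultimately show "(y, x) \<in> r" using gh(1-4) by (intro rI[of h g]) simp_all
      qed
      show "trans r"
      proof (rule transI)
        fix x y z assume "(x, y) \<in> r" "(y, z) \<in> r"
        then obtain g h k l where gh: "g \<in> G" "h \<in> G" "x = g \<alpha>" "y = h \<alpha>"
            "inv\<^bsub>?P\<^esub> g \<otimes>\<^bsub>?P\<^esub> h \<in> K"
          and kl: "k \<in> G" "l \<in> G" "y = k \<alpha>" "z = l \<alpha>" "inv\<^bsub>?P\<^esub> k \<otimes>\<^bsub>?P\<^esub> l \<in> K"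
          unfolding r_def by blast
        have "inv\<^bsub>?P\<^esub> h \<otimes>\<^bsub>?P\<^esub> k \<in> K" using gh kl by (intro mem_K) auto
        then have "(inv\<^bsub>?P\<^esub> g \<otimes>\<^bsub>?P\<^esub> h) \<otimes>\<^bsub>?P\<^esub> ((inv\<^bsub>?P\<^esub> h \<otimes>\<^bsub>?P\<^esub> k) \<otimes>\<^bsub>?P\<^esub> (inv\<^bsub>?P\<^esub> k \<otimes>\<^bsub>?P\<^esub> l)) \<in> K"
          using gh kl K(1) by (simp only: subgroup.m_closed)
        moreover have "(inv\<^bsub>?P\<^esub> g \<otimes>\<^bsub>?P\<^esub> h) \<otimes>\<^bsub>?P\<^esub> ((inv\<^bsub>?P\<^esub> h \<otimes>\<^bsub>?P\<^esub> k) \<otimes>\<^bsub>?P\<^esub> (inv\<^bsub>?P\<^esub> k \<otimes>\<^bsub>?P\<^esub> l)) =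
            inv\<^bsub>?P\<^esub> g \<otimes>\<^bsub>?P\<^esub> l"
        proof -
          have c: "g \<in> carrier ?P" "h \<in> carrier ?P" "k \<in> carrier ?P" "l \<in> carrier ?P"
            using gh kl by simp_all
          show ?thesis
            using c P.inv_closed[OF c(1)] P.inv_closed[OF c(2)] P.inv_closed[OF c(3)]
            by (simp only: P.word_simps P.m_closed)
        qed
        ultimately show "(x, z) \<in> r" using gh(1-4) kl(1-4) by (intro rI[of g l]) simp_all
      qed
    qed
    moreover have "(g x, g y) \<in> r" if "g \<in> G" "(x, y) \<in> r" for g x y
    proof -
      obtain h k where hk: "h \<in> G" "k \<in> G" "x = h \<alpha>" "y = k \<alpha>" "inv\<^bsub>?P\<^esub> h \<otimes>\<^bsub>?P\<^esub> k \<in> K"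
        using \<open>(x, y) \<in> r\<close> unfolding r_def by blast
      have c: "g \<in> carrier ?P" "h \<in> carrier ?P" "k \<in> carrier ?P" using hk that by simp_all
      have "inv\<^bsub>?P\<^esub> (g \<otimes>\<^bsub>?P\<^esub> h) \<otimes>\<^bsub>?P\<^esub> (g \<otimes>\<^bsub>?P\<^esub> k) = inv\<^bsub>?P\<^esub> h \<otimes>\<^bsub>?P\<^esub> k"
        using c P.inv_closed[OF c(1)] P.inv_closed[OF c(2)]
        by (simp only: P.word_simps P.m_closed)
      moreover have "g x = (g \<otimes>\<^bsub>?P\<^esub> h) \<alpha>" "g y = (g \<otimes>\<^bsub>?P\<^esub> k) \<alpha>"
        using hk that \<alpha> by (simp_all add: apply_mult)
      ultimately show ?thesis
        using hk \<open>g \<in> G\<close> by (intro rI[of "g \<otimes>\<^bsub>?P\<^esub> h" "g \<otimes>\<^bsub>?P\<^esub> k"]) (simp_all add: mult_G)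
    qed
    ultimately have "equiv \<Omega> r \<and> (\<forall>g\<in>G. \<forall>(x, y)\<in>r. (g x, g y) \<in> r)" by blast
    then consider "r = Id_on \<Omega>" | "r = \<Omega> \<times> \<Omega>"
      using prim unfolding primitive_perm_group_def by meson
    then show "K = ?H \<or> K = carrier ?P"
    proof cases
      case 1
      have "k \<in> ?H" if k: "k \<in> K" for k
      proof -
        have "k \<in> G" using k KG by auto
        then have "(\<one>\<^bsub>?P\<^esub> \<alpha>, k \<alpha>) \<in> r"
          using k P.one_closed P.l_one[of k] P.inv_one
          by (intro rI[of "\<one>\<^bsub>?P\<^esub>" k]) simp_all
        then show ?thesis using 1 apply_one[OF \<alpha>] \<open>k \<in> G\<close> H by auto
      qed
      then show ?thesis using K(2) by blast
    next
      case 2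
      have "g \<in> K" if g: "g \<in> G" for g
      proof -
        have "(\<alpha>, g \<alpha>) \<in> r" using 2 g \<alpha> closed by simp
        then obtain h k where hk: "h \<in> G" "k \<in> G" "\<alpha> = h \<alpha>" "g \<alpha> = k \<alpha>"
          "inv\<^bsub>?P\<^esub> h \<otimes>\<^bsub>?P\<^esub> k \<in> K" unfolding r_def by blast
        have "h \<in> ?H" unfolding H using hk by simp
        then have "h \<in> K" using K(2) by (rule rev_subsetD)
        moreover have "inv\<^bsub>?P\<^esub> k \<otimes>\<^bsub>?P\<^esub> g \<in> K" using hk(2) g hk(4)[symmetric] by (rule mem_K)
        ultimately have "h \<otimes>\<^bsub>?P\<^esub> ((inv\<^bsub>?P\<^esub> h \<otimes>\<^bsub>?P\<^esub> k) \<otimes>\<^bsub>?P\<^esub> (inv\<^bsub>?P\<^esub> k \<otimes>\<^bsub>?P\<^esub> g)) \<in> K"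
          using hk K(1) by (simp only: subgroup.m_closed)
        moreover have "h \<otimes>\<^bsub>?P\<^esub> ((inv\<^bsub>?P\<^esub> h \<otimes>\<^bsub>?P\<^esub> k) \<otimes>\<^bsub>?P\<^esub> (inv\<^bsub>?P\<^esub> k \<otimes>\<^bsub>?P\<^esub> g)) = g"
        proof -
          have c: "g \<in> carrier ?P" "h \<in> carrier ?P" "k \<in> carrier ?P"
            using hk g by simp_all
          show ?thesis
            using c P.inv_closed[OF c(2)] P.inv_closed[OF c(3)]
            by (simp only: P.word_simps P.m_closed)
        qed
        ultimately show ?thesis by simp
      qed
      then show ?thesis using KG by auto
    qed
  qed
qed

text \<open>
  \<open>N\<close> is transitive since \<open>G = N H\<close> for every point stabiliser \<open>H\<close>, and a transitive abelian group is
  regular: an element that fixes one point commutes with elements carrying this point to any other.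
\<close>

lemma affine_typeI:
  assumes fin: "finite \<Omega>" "\<Omega> \<noteq> {}" and prim: "primitive_perm_group \<Omega> G"
    and N: "group.minimal_normalized (perm_group \<Omega> G) G N"
    and comm: "\<And>x y. x \<in> N \<Longrightarrow> y \<in> N \<Longrightarrow> x \<otimes>\<^bsub>perm_group \<Omega> G\<^esub> y = y \<otimes>\<^bsub>perm_group \<Omega> G\<^esub> x"
  shows "affine_type \<Omega> G"
proof -
  let ?P = "perm_group \<Omega> G" and ?V = "perm_group \<Omega> N"
  have sub: "subgroup G (BijGroup \<Omega>)" and trans: "transitive_action ?P \<Omega> (\<lambda>g. g)"
    using prim by (auto simp: primitive_perm_group_def transitive_perm_group_def)
  interpret act: transitive_action ?P \<Omega> "\<lambda>g. g" by fact
  interpret P: group ?P using act.group_hom by (simp add: group_hom_def)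
  have normal: "N \<lhd> ?P" using N P.normal_minimal_normalized by simp
  have NP: "subgroup N ?P" "N \<noteq> {\<one>\<^bsub>?P\<^esub>}" using N by (auto simp: P.minimal_normalized_def)
  have NG: "N \<subseteq> G" using subgroup.subset[OF NP(1)] by simp
  have apply_mult: "(g \<otimes>\<^bsub>BijGroup \<Omega>\<^esub> h) x = g (h x)" if "g \<in> G" "h \<in> G" "x \<in> \<Omega>" for g h x
    using act.composition_rule[of x g h] that by simp
  have V: "?P\<lparr>carrier := N\<rparr> = ?V" by simp
  have groupV: "group ?V" using P.subgroup_imp_group[OF NP(1)] by simp
  have "\<exists>p::nat. Factorial_Ring.prime p \<and> (\<forall>v\<in>N. v [^]\<^bsub>?P\<^esub> p = \<one>\<^bsub>?P\<^esub>)"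
  proof -
    obtain \<alpha> where "\<alpha> \<in> \<Omega>" using fin(2) by blast
    then have "finite (carrier ?P)"
      using primitive_core_free_maximal[OF fin(1) prim]
      by (blast dest: core_free_maximal_subgroup.finite_carrier)
    then show ?thesis
      using P.minimal_normal_commutative_exponent[of N] N comm by simp
  qed
  moreover have "v [^]\<^bsub>?V\<^esub> p = v [^]\<^bsub>?P\<^esub> p" for v and p :: nat
    by (simp add: nat_pow_def)
  moreover have "comm_group ?V"
    using comm by (intro group.group_comm_groupI[OF groupV]) simp
  ultimately have elementary: "elementary_abelian ?V"
    by (simp add: elementary_abelian_def)
  have transN: "\<exists>n\<in>N. n x = y" if x: "x \<in> \<Omega>" and y: "y \<in> \<Omega>" for x y
  proof -
    interpret core_free_maximal_subgroup ?P "point_stabilizer \<Omega> G x"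
      using fin(1) prim x by (rule primitive_core_free_maximal)
    obtain g where g: "g \<in> G" "g x = y" using act.unique_orbit[OF x y] by auto
    have "g \<in> N <#>\<^bsub>?P\<^esub> point_stabilizer \<Omega> G x"
      using normal_supplement[OF normal NP(2)] g(1) by simp
    then obtain n h where "n \<in> N" "h \<in> G" "h x = x" "g = n \<otimes>\<^bsub>?P\<^esub> h"
      by (auto simp: set_mult_def stabilizer_def)
    then have "n x = y" using g(2) NG x apply_mult[of n h x] by auto
    then show ?thesis using \<open>n \<in> N\<close> by blast
  qed
  have "group_action ?V \<Omega> (\<lambda>g. g)"
    using act.induced_action[OF NP(1)] by simp
  then have "transitive_action ?V \<Omega> (\<lambda>g. g)"
    using transN by (simp add: transitive_action_def transitive_action_axioms_def)
  moreover have "subgroup N (BijGroup \<Omega>)"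
    using group.incl_subgroup[OF group_BijGroup sub NP(1)] .
  moreover have "point_stabilizer \<Omega> N \<beta> = {\<one>\<^bsub>BijGroup \<Omega>\<^esub>}" if \<beta>: "\<beta> \<in> \<Omega>" for \<beta>
  proof -
    have "v = \<one>\<^bsub>?P\<^esub>" if v: "v \<in> N" "v \<beta> = \<beta>" for v
    proof (rule perm_group_eqI[OF act.group_action_axioms])
      show "v \<in> G" "\<one>\<^bsub>?P\<^esub> \<in> G" using v NG P.one_closed by auto
      fix x assume x: "x \<in> \<Omega>"
      obtain n where n: "n \<in> N" "n \<beta> = x" using transN \<beta> x by blast
      have nv: "n \<in> G" "v \<in> G" using n v NG by auto
      have "v x = (v \<otimes>\<^bsub>?P\<^esub> n) \<beta>" using n(2) apply_mult[OF nv(2,1) \<beta>] by simp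
      also have "\<dots> = (n \<otimes>\<^bsub>?P\<^esub> v) \<beta>" using comm[OF v(1) n(1)] by simp
      also have "\<dots> = x" using n(2) v(2) apply_mult[OF nv \<beta>] by simp
      finally show "v x = \<one>\<^bsub>?P\<^esub> x" using act.id_eq_one x by (metis restrict_apply')
    qed
    moreover have "\<one>\<^bsub>?P\<^esub> \<beta> = \<beta>" using act.id_eq_one \<beta> by (metis restrict_apply')
    moreover have "v \<in> point_stabilizer \<Omega> N \<beta> \<longleftrightarrow> v \<in> N \<and> v \<beta> = \<beta>" for v
      by (simp add: stabilizer_def)
    ultimately have "point_stabilizer \<Omega> N \<beta> = {\<one>\<^bsub>?P\<^esub>}"
      using subgroup.one_closed[OF NP(1)] by blast
    then show ?thesis by simp
  qed
  ultimately have "regular_perm_group \<Omega> N"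
    by (simp add: regular_perm_group_def transitive_perm_group_def)
  then show ?thesis using normal elementary by (auto simp: affine_type_def)
qed

theorem proposition3p1:
  fixes \<Omega> :: "'a set" and G :: "('a \<Rightarrow> 'a) set"
  assumes "finite \<Omega>" and "\<Omega> \<noteq> {}"
    and "primitive_perm_group \<Omega> G"
    and "\<And>\<alpha>. \<alpha> \<in> \<Omega> \<Longrightarrow> is_dihedral (perm_group \<Omega> (point_stabilizer \<Omega> G \<alpha>))"
  shows "affine_type \<Omega> G \<or> almost_simple (perm_group \<Omega> G)"
proof -
  obtain \<alpha> where \<alpha>: "\<alpha> \<in> \<Omega>" using assms(2) by blast
  let ?H = "point_stabilizer \<Omega> G \<alpha>"
  interpret core_free_maximal_subgroup "perm_group \<Omega> G" ?H
    using assms(1,3) \<alpha> by (rule primitive_core_free_maximal)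
  have dih: "is_dihedral (perm_group \<Omega> G\<lparr>carrier := ?H\<rparr>)"
    using assms(4)[OF \<alpha>] by simp
  obtain C where "rotations C ?H" "?H \<noteq> {\<one>\<^bsub>perm_group \<Omega> G\<^esub>}"
    using rotations_of_dihedral[OF subgroup_H dih] by blast
  then show ?thesis
  proof (cases rule: dihedral_cases)
    case (commutative N)
    have "affine_type \<Omega> G"
      by (rule affine_typeI[OF assms(1-3)]) (use commutative in auto)
    then show ?thesis ..
  next
    case (simple N)
    have "finite N"
      using subgroup.subset[OF normal_imp_subgroup[OF simple(1)]] by (rule finite_subset_carrier)
    then have "almost_simple (perm_group \<Omega> G)"
      using almost_simpleI[OF is_group simple(1) _ simple(3,4,2)] by simp
    then show ?thesis ..
  qed
qed

end
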